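(* Let $G$ be a Fuchsian group of the first kind, let $k$ be an even integer, let $\mathbb{X}:\mathbb{H}\to\mathbb{C}^m$ be a non-zero meromorphic function and let $\rho:G\to\mathrm{GL}_m(\mathbb{C})$ be a representation. Suppose that $\mathbb{X}(\gamma\tau)=(c\tau+d)^k\rho(\gamma)\mathbb{X}(\tau)$ for all $\gamma=\begin{pmatrix}a&b\\c&d\end{pmatrix}\in G$ and $\tau\in\mathbb{H}$. Then the following hold. (a) Suppose there exists a constant $\zeta>0$ such that $\|\mathbb{X}(x+iy)\|\ll y^{-\zeta}$ for all $x+iy\in\mathbb{H}$. If $\rho$ is irreducible, then $\|\rho(\gamma)\|\ll\|\gamma\|^{2\zeta-k}$ for all $\gamma\in G$. (b) More generally, suppose there exists a constant $\zeta>0$ such that $\|\mathbb{X}(x+iy)\|\ll\max_{0\le j\le m-1}\{|x+iy|^j y^{-\zeta}\}$ for all $x+iy\in\mathbb{H}$. If $\rho$ is irreducible, then $\|\rho(\gamma)\|\ll\max_{0\le j\le m-1}\{\|\gamma\|^{j+2\zeta-k}\}$ for all $\gamma\in G$. (c) If $\rho$ is not necessarily irreducible, then some irreducible component of $\rho$ has a similar growth: under the growth hypothesis on $\mathbb{X}$ in (a) (respectively in (b)), there is an irreducible constituent $\sigma$ of $\rho$ such that $\|\sigma(\gamma)\|\ll\|\gamma\|^{2\zeta-k}$ (respectively $\|\sigma(\gamma)\|\ll\max_{0\le j\le m-1}\{\|\gamma\|^{j+2\zeta-k}\}$) for all $\gamma\in G$.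
   Context: $\mathbb{H}$ is the upper half plane. A Fuchsian group is a discrete subgroup $G$ of $\mathrm{PSL}_2(\mathbb{R})$ such that $G\backslash\mathbb{H}$ is topologically a Riemann surface with finitely many punctures; it is of the first kind if a fundamental domain has finite hyperbolic area. The norm $\|\cdot\|$ of a vector or a matrix is the usual Euclidean norm (of the entries). The notation $f\ll g$ means $|f|\le C|g|$ with a constant $C$ that does not depend on the variable ($x+iy\in\mathbb{H}$, respectively $\gamma\in G$). *)

theory Defs
  imports "HOL-Complex_Analysis.Complex_Analysis" "HOL-Algebra.Coset"
begin

section \<open>The group \<open>PSL\<^sub>2(\<real>)\<close> and its action on the upper half plane\<close>

definition upper_half_plane :: "complex set" where
  "upper_half_plane = {\<tau>. Im \<tau> > 0}"

definition SL2R :: "(real^2^2) monoid" where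
  "SL2R = \<lparr>carrier = {A. det A = 1}, mult = (**), one = mat 1\<rparr>"

text \<open>The elements of \<open>PSL2R\<close> are the two-element sets \<open>{A, - A}\<close> with \<open>det A = 1\<close>; thus
  \<open>A \<in> \<gamma>\<close> says that the matrix \<open>A\<close> represents \<open>\<gamma>\<close>.\<close>

definition PSL2R :: "(real^2^2) set monoid" where
  "PSL2R = SL2R Mod {mat 1, - mat 1}"

definition automorphy_factor :: "real^2^2 \<Rightarrow> complex \<Rightarrow> complex" where
  "automorphy_factor A \<tau> = of_real (A $ 2 $ 1) * \<tau> + of_real (A $ 2 $ 2)"

definition moebius :: "real^2^2 \<Rightarrow> complex \<Rightarrow> complex" where
  "moebius A \<tau> = (of_real (A $ 1 $ 1) * \<tau> + of_real (A $ 1 $ 2)) / automorphy_factor A \<tau>"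

definition orbit :: "(real^2^2) set set \<Rightarrow> complex \<Rightarrow> complex set" where
  "orbit G \<tau> = {moebius A \<tau> | A \<gamma>. \<gamma> \<in> G \<and> A \<in> \<gamma>}"

definition quotient_topology :: "'a topology \<Rightarrow> ('a \<Rightarrow> 'b) \<Rightarrow> 'b topology" where
  "quotient_topology X q =
     topology (\<lambda>U. U \<subseteq> q ` topspace X \<and> openin X {x \<in> topspace X. q x \<in> U})"

definition PSL2R_topology :: "(real^2^2) set topology" where
  "PSL2R_topology =
     quotient_topology (top_of_set (carrier SL2R)) (\<lambda>A. {mat 1, - mat 1} #>\<^bsub>SL2R\<^esub> A)"

definition orbit_space :: "(real^2^2) set set \<Rightarrow> complex set topology" where
  "orbit_space G = quotient_topology (top_of_set upper_half_plane) (orbit G)"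

section \<open>Riemann surfaces\<close>

definition complex_atlas :: "'a topology \<Rightarrow> ('a set \<times> ('a \<Rightarrow> complex)) set \<Rightarrow> bool" where
  "complex_atlas X \<A> \<longleftrightarrow>
     (\<Union>(U, \<phi>)\<in>\<A>. U) = topspace X \<and>
     (\<forall>(U, \<phi>)\<in>\<A>. openin X U \<and> open (\<phi> ` U) \<and>
        homeomorphic_map (subtopology X U) (top_of_set (\<phi> ` U)) \<phi>) \<and>
     (\<forall>(U, \<phi>)\<in>\<A>. \<forall>(V, \<psi>)\<in>\<A>. (\<lambda>z. \<psi> (inv_into U \<phi> z)) holomorphic_on (\<phi> ` (U \<inter> V)))"

definition Riemann_surface :: "'a topology \<Rightarrow> bool" where
  "Riemann_surface X \<longleftrightarrow>
     topspace X \<noteq> {} \<and> connected_space X \<and> Hausdorff_space X \<and> (\<exists>\<A>. complex_atlas X \<A>)"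

text \<open>A compact Riemann surface has at most the cardinality of the continuum, so it loses no
  generality to let its points be elements of the type \<^typ>\<open>complex\<close>; the topology of \<open>S\<close> below
  is arbitrary and has nothing to do with the usual topology of \<^typ>\<open>complex\<close>.\<close>

definition finitely_punctured_Riemann_surface :: "'a topology \<Rightarrow> bool" where
  "finitely_punctured_Riemann_surface X \<longleftrightarrow>
     (\<exists>(S :: complex topology) P. Riemann_surface S \<and> compact_space S \<and> finite P \<and>
        X homeomorphic_space subtopology S (topspace S - P))"

section \<open>Fuchsian groups of the first kind\<close>

definition Fuchsian_group :: "(real^2^2) set set \<Rightarrow> bool" where
  "Fuchsian_group G \<longleftrightarrow>
     subgroup G PSL2R \<and> subtopology PSL2R_topology G = discrete_topology G \<and>
     finitely_punctured_Riemann_surface (orbit_space G)"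

definition fundamental_domain :: "(real^2^2) set set \<Rightarrow> complex set \<Rightarrow> bool" where
  "fundamental_domain G F \<longleftrightarrow>
     closedin (top_of_set upper_half_plane) F \<and> F \<subseteq> closure (interior F) \<and>
     (\<Union>\<gamma>\<in>G. \<Union>A\<in>\<gamma>. moebius A ` F) = upper_half_plane \<and>
     (\<forall>\<gamma>\<in>G - {\<one>\<^bsub>PSL2R\<^esub>}. \<forall>A\<in>\<gamma>. interior F \<inter> moebius A ` interior F = {})"

definition hyperbolic_area :: "complex set \<Rightarrow> ennreal" where
  "hyperbolic_area F = (\<integral>\<^sup>+\<tau>\<in>F. ennreal (1 / (Im \<tau>)\<^sup>2) \<partial>lborel)"

definition Fuchsian_group_first_kind :: "(real^2^2) set set \<Rightarrow> bool" where
  "Fuchsian_group_first_kind G \<longleftrightarrow>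
     Fuchsian_group G \<and> (\<exists>F. fundamental_domain G F \<and> hyperbolic_area F < \<infinity>)"

section \<open>Vector-valued meromorphic functions\<close>

text \<open>Removable singularities are required to be filled in, and a component of \<open>X\<close> has the
  dummy value \<open>0\<close> at each of its poles. So \<open>X\<close> is non-zero as a meromorphic function if and only
  if \<open>X \<tau> \<noteq> 0\<close> for some \<open>\<tau>\<close>.\<close>

definition meromorphic_vector :: "(complex \<Rightarrow> complex^'m) \<Rightarrow> complex set \<Rightarrow> bool" where
  "meromorphic_vector X S \<longleftrightarrow> (\<forall>i. (\<lambda>\<tau>. X \<tau> $ i) nicely_meromorphic_on S)"

definition vector_pole :: "(complex \<Rightarrow> complex^'m) \<Rightarrow> complex \<Rightarrow> bool" where
  "vector_pole X \<tau> \<longleftrightarrow> (\<exists>i. is_pole (\<lambda>t. X t $ i) \<tau>)"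

text \<open>The transformation law is an identity of meromorphic functions, so it is only imposed where
  the dummy values at poles do not enter.\<close>

definition transforms_with_weight ::
    "(real^2^2) set set \<Rightarrow> int \<Rightarrow> ((real^2^2) set \<Rightarrow> complex^'m^'m) \<Rightarrow>
     (complex \<Rightarrow> complex^'m) \<Rightarrow> bool" where
  "transforms_with_weight G k \<rho> X \<longleftrightarrow>
     (\<forall>\<gamma>\<in>G. \<forall>A\<in>\<gamma>. \<forall>\<tau>\<in>upper_half_plane.
        \<not> vector_pole X \<tau> \<and> \<not> vector_pole X (moebius A \<tau>) \<longrightarrow>
        X (moebius A \<tau>) = automorphy_factor A \<tau> powi k *s (\<rho> \<gamma> *v X \<tau>))"

section \<open>Representations\<close>

definition GL :: "(complex^'m^'m) monoid" where
  "GL = \<lparr>carrier = {A. invertible A}, mult = (**), one = mat 1\<rparr>"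

definition GL_representation :: "('g, 'b) monoid_scheme \<Rightarrow> ('g \<Rightarrow> complex^'m^'m) \<Rightarrow> bool" where
  "GL_representation \<Gamma> \<rho> \<longleftrightarrow> \<rho> \<in> hom \<Gamma> GL"

definition invariant_subspace ::
    "('g, 'b) monoid_scheme \<Rightarrow> ('g \<Rightarrow> complex^'m^'m) \<Rightarrow> (complex^'m) set \<Rightarrow> bool" where
  "invariant_subspace \<Gamma> \<rho> U \<longleftrightarrow>
     vec.subspace U \<and> (\<forall>g\<in>carrier \<Gamma>. \<forall>u\<in>U. \<rho> g *v u \<in> U)"

definition irreducible_representation ::
    "('g, 'b) monoid_scheme \<Rightarrow> ('g \<Rightarrow> complex^'m^'m) \<Rightarrow> bool" where
  "irreducible_representation \<Gamma> \<rho> \<longleftrightarrow>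
     (\<forall>U. invariant_subspace \<Gamma> \<rho> U \<longrightarrow> U = {0} \<or> U = UNIV)"

definition basis_modulo ::
    "(complex^'m) set \<Rightarrow> (complex^'m) set \<Rightarrow> nat \<Rightarrow> (nat \<Rightarrow> complex^'m) \<Rightarrow> bool" where
  "basis_modulo U W n w \<longleftrightarrow>
     (\<forall>i<n. w i \<in> W) \<and>
     (\<forall>v\<in>W. \<exists>c. v - (\<Sum>i<n. c i *s w i) \<in> U) \<and>
     (\<forall>c. (\<Sum>i<n. c i *s w i) \<in> U \<longrightarrow> (\<forall>i<n. c i = 0))"

text \<open>The irreducible constituents of \<open>\<rho>\<close> are its composition factors: the action of the group on
  \<open>W / U\<close> for invariant subspaces \<open>U \<subset> W\<close> without invariant subspaces in between. Since the
  dimension \<open>n\<close> of \<open>W / U\<close> is not a type, the matrix of \<open>g\<close> with respect to a basis of \<open>W / U\<close> is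
  \<open>\<sigma> g\<close> with entries \<open>\<sigma> g i j\<close> for \<open>i, j < n\<close>.\<close>

definition irreducible_constituent ::
    "('g, 'b) monoid_scheme \<Rightarrow> ('g \<Rightarrow> complex^'m^'m) \<Rightarrow>
     nat \<Rightarrow> ('g \<Rightarrow> nat \<Rightarrow> nat \<Rightarrow> complex) \<Rightarrow> bool" where
  "irreducible_constituent \<Gamma> \<rho> n \<sigma> \<longleftrightarrow>
     (\<exists>U W w.
        invariant_subspace \<Gamma> \<rho> U \<and> invariant_subspace \<Gamma> \<rho> W \<and> U \<subset> W \<and>
        (\<forall>V. invariant_subspace \<Gamma> \<rho> V \<and> U \<subseteq> V \<and> V \<subseteq> W \<longrightarrow> V = U \<or> V = W) \<and>
        basis_modulo U W n w \<and>
        (\<forall>g\<in>carrier \<Gamma>. \<forall>j<n. \<rho> g *v w j - (\<Sum>i<n. \<sigma> g i j *s w i) \<in> U))"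

definition entries_norm :: "nat \<Rightarrow> (nat \<Rightarrow> nat \<Rightarrow> complex) \<Rightarrow> real" where
  "entries_norm n M = sqrt (\<Sum>i<n. \<Sum>j<n. (cmod (M i j))\<^sup>2)"

section \<open>Basic facts\<close>

lemma group_SL2R: "group SL2R"
proof (rule groupI)
  fix A assume "A \<in> carrier SL2R"
  then have A: "det A = 1" by (simp add: SL2R_def)
  then have "invertible A" by (simp add: invertible_det_nz)
  then obtain B where B: "A ** B = mat 1" "B ** A = mat 1"
    by (auto simp: invertible_def)
  have "det B = 1"
    using arg_cong[OF B(1), of det] A by (simp add: det_mul)
  with B show "\<exists>B\<in>carrier SL2R. B \<otimes>\<^bsub>SL2R\<^esub> A = \<one>\<^bsub>SL2R\<^esub>"
    by (auto simp: SL2R_def)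
qed (auto simp: SL2R_def det_mul matrix_mul_assoc)

lemma det_uminus_2: "det (- A) = det (A :: real^2^2)"
  by (simp add: det_2)

lemma matrix_uminus_left: "(- A) ** B = - (A ** (B :: real^2^2))"
  by (simp add: matrix_matrix_mult_def vec_eq_iff sum_negf)

lemma matrix_uminus_right: "A ** (- B) = - (A ** (B :: real^2^2))"
  by (simp add: matrix_matrix_mult_def vec_eq_iff sum_negf)

lemma normal_center_SL2R: "{mat 1, - mat 1} \<lhd> SL2R"
proof -
  interpret group SL2R by (rule group_SL2R)
  have sub: "subgroup {mat 1, - mat 1} SL2R"
  proof (rule subgroupI)
    show "{mat 1, - mat 1} \<subseteq> carrier SL2R"
      by (simp add: SL2R_def det_uminus_2)
    fix A assume "A \<in> {mat 1 :: real^2^2, - mat 1}"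
    then have *: "A \<in> carrier SL2R" "A \<otimes>\<^bsub>SL2R\<^esub> A = \<one>\<^bsub>SL2R\<^esub>" "A \<in> {mat 1, - mat 1}"
      by (auto simp: SL2R_def det_uminus_2 matrix_uminus_left matrix_uminus_right)
    then show "inv\<^bsub>SL2R\<^esub> A \<in> {mat 1, - mat 1}"
      using inv_equality by metis
  qed (auto simp: SL2R_def matrix_uminus_left matrix_uminus_right)
  show ?thesis
    unfolding normal_inv_iff
  proof (intro conjI ballI sub)
    fix A B assume A: "A \<in> carrier SL2R" and B: "B \<in> {mat 1 :: real^2^2, - mat 1}"
    then have "B \<in> carrier SL2R" using sub subgroup.subset by blast
    moreover have "A \<otimes>\<^bsub>SL2R\<^esub> B = B \<otimes>\<^bsub>SL2R\<^esub> A"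
      using B by (auto simp: SL2R_def matrix_uminus_left matrix_uminus_right)
    ultimately have "A \<otimes>\<^bsub>SL2R\<^esub> B \<otimes>\<^bsub>SL2R\<^esub> inv\<^bsub>SL2R\<^esub> A = B"
      using A by (simp add: m_assoc)
    with B show "A \<otimes>\<^bsub>SL2R\<^esub> B \<otimes>\<^bsub>SL2R\<^esub> inv\<^bsub>SL2R\<^esub> A \<in> {mat 1, - mat 1}" by simp
  qed
qed

lemma group_PSL2R: "group PSL2R"
  unfolding PSL2R_def by (rule normal.factorgroup_is_group[OF normal_center_SL2R])

lemma carrier_PSL2R: "carrier PSL2R = {{A, - A} | A. det A = 1}"
  by (auto simp: PSL2R_def carrier_FactGroup r_coset_def SL2R_def matrix_uminus_left)

lemma quotient_map_quotient_topology: "quotient_map X (quotient_topology X q) q"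
proof -
  have "istopology (\<lambda>U. U \<subseteq> q ` topspace X \<and> openin X {x \<in> topspace X. q x \<in> U})"
  proof -
    have "{x \<in> topspace X. q x \<in> S \<inter> T}
        = {x \<in> topspace X. q x \<in> S} \<inter> {x \<in> topspace X. q x \<in> T}" for S T by auto
    moreover have "{x \<in> topspace X. q x \<in> \<Union>\<K>}
        = (\<Union>K\<in>\<K>. {x \<in> topspace X. q x \<in> K})" for \<K> by auto
    ultimately show ?thesis
      unfolding istopology_def by (auto intro!: openin_Int openin_Union)
  qed
  then have *: "openin (quotient_topology X q) U \<longleftrightarrow>
      U \<subseteq> q ` topspace X \<and> openin X {x \<in> topspace X. q x \<in> U}" for U
    unfolding quotient_topology_def by (simp add: topology_inverse')
  have "topspace (quotient_topology X q) = q ` topspace X"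
  proof
    have "{x \<in> topspace X. q x \<in> q ` topspace X} = topspace X" by auto
    then show "q ` topspace X \<subseteq> topspace (quotient_topology X q)"
      by (intro openin_subset) (simp add: *)
    show "topspace (quotient_topology X q) \<subseteq> q ` topspace X"
      using * openin_topspace by blast
  qed
  then show ?thesis by (auto simp: quotient_map_def *)
qed

lemma irreducible_constituent_mult:
  assumes "irreducible_constituent \<Gamma> \<rho> n \<sigma>" "GL_representation \<Gamma> \<rho>" "group \<Gamma>"
    and gh: "g \<in> carrier \<Gamma>" "h \<in> carrier \<Gamma>" and ij: "i < n" "j < n"
  shows "\<sigma> (g \<otimes>\<^bsub>\<Gamma>\<^esub> h) i j = (\<Sum>l<n. \<sigma> g i l * \<sigma> h l j)"
proof -
  obtain U W w where U: "invariant_subspace \<Gamma> \<rho> U" and bas: "basis_modulo U W n w"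
    and \<sigma>: "\<And>g j. g \<in> carrier \<Gamma> \<Longrightarrow> j < n \<Longrightarrow> \<rho> g *v w j - (\<Sum>i<n. \<sigma> g i j *s w i) \<in> U"
    using assms(1) unfolding irreducible_constituent_def by metis
  have indep: "\<And>c. (\<Sum>i<n. c i *s w i) \<in> U \<Longrightarrow> \<forall>i<n. c i = 0"
    using bas unfolding basis_modulo_def by simp
  have sub: "vec.subspace U" and inv: "\<And>u. u \<in> U \<Longrightarrow> \<rho> g *v u \<in> U"
    using U gh unfolding invariant_subspace_def by auto
  have gh': "g \<otimes>\<^bsub>\<Gamma>\<^esub> h \<in> carrier \<Gamma>"
    using assms(3) gh by (simp add: group.is_monoid monoid.m_closed)
  have hom: "\<rho> (g \<otimes>\<^bsub>\<Gamma>\<^esub> h) = \<rho> g ** \<rho> h"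
    using assms(2) gh by (auto simp: GL_representation_def hom_def GL_def)
  let ?a = "\<rho> g *v (\<rho> h *v w j - (\<Sum>l<n. \<sigma> h l j *s w l))"
  let ?b = "\<Sum>l<n. \<sigma> h l j *s (\<rho> g *v w l - (\<Sum>i<n. \<sigma> g i l *s w i))"
  let ?c = "\<rho> (g \<otimes>\<^bsub>\<Gamma>\<^esub> h) *v w j - (\<Sum>i<n. \<sigma> (g \<otimes>\<^bsub>\<Gamma>\<^esub> h) i j *s w i)"
  have "?a \<in> U" by (intro inv \<sigma> gh ij)
  moreover have "?b \<in> U"
    by (intro vec.subspace_sum[OF sub] vec.subspace_scale[OF sub] \<sigma> gh) simp
  moreover have "?c \<in> U" by (intro \<sigma> gh' ij)
  ultimately have "?a + ?b - ?c \<in> U"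
    by (rule vec.subspace_diff[OF sub vec.subspace_add[OF sub]])
  moreover have "?a + ?b - ?c =
      (\<Sum>i<n. (\<sigma> (g \<otimes>\<^bsub>\<Gamma>\<^esub> h) i j - (\<Sum>l<n. \<sigma> g i l * \<sigma> h l j)) *s w i)"
  proof -
    have "(\<Sum>l<n. \<sigma> h l j *s (\<Sum>i<n. \<sigma> g i l *s w i))
        = (\<Sum>l<n. \<Sum>i<n. (\<sigma> g i l * \<sigma> h l j) *s w i)"
      by (simp only: vec.scale_sum_right vec.scale_scale mult.commute)
    also have "\<dots> = (\<Sum>i<n. \<Sum>l<n. (\<sigma> g i l * \<sigma> h l j) *s w i)"
      by (rule sum.swap)
    also have "\<dots> = (\<Sum>i<n. (\<Sum>l<n. \<sigma> g i l * \<sigma> h l j) *s w i)"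
      by (simp only: vec.scale_sum_left)
    finally have swap: "(\<Sum>l<n. \<sigma> h l j *s (\<Sum>i<n. \<sigma> g i l *s w i)) = \<dots>" .
    have a: "?a = \<rho> g *v (\<rho> h *v w j) - (\<Sum>l<n. \<sigma> h l j *s (\<rho> g *v w l))"
      by (simp only: vec.diff vec.sum vec.scale)
    have b: "?b = (\<Sum>l<n. \<sigma> h l j *s (\<rho> g *v w l))
        - (\<Sum>l<n. \<sigma> h l j *s (\<Sum>i<n. \<sigma> g i l *s w i))"
      by (simp only: vec.scale_right_diff_distrib sum_subtractf)
    have c: "?c = \<rho> g *v (\<rho> h *v w j) - (\<Sum>i<n. \<sigma> (g \<otimes>\<^bsub>\<Gamma>\<^esub> h) i j *s w i)"
      by (simp only: hom matrix_vector_mul_assoc)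
    show ?thesis
      unfolding a b c swap
      by (simp only: vec.scale_left_diff_distrib sum_subtractf) simp
  qed
  ultimately have "(\<Sum>i<n. (\<sigma> (g \<otimes>\<^bsub>\<Gamma>\<^esub> h) i j - (\<Sum>l<n. \<sigma> g i l * \<sigma> h l j)) *s w i) \<in> U"
    by simp
  then have "\<forall>i<n. \<sigma> (g \<otimes>\<^bsub>\<Gamma>\<^esub> h) i j - (\<Sum>l<n. \<sigma> g i l * \<sigma> h l j) = 0"
    by (rule indep)
  then show ?thesis using ij by simp
qed

end

theory Submission
  imports Defs
begin

text \<open>
  Write \<open>j(A, \<tau>) = c * \<tau> + d\<close> for the automorphy factor and \<open>s = 2 * \<zeta> - k\<close>. The
  transformation law gives \<open>\<rho>(\<gamma>) X(\<tau>) = j(A, \<tau>)\<^sup>-\<^sup>k X(A \<tau>)\<close>, and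
  \<open>Im (A \<tau>) = Im \<tau> / |j(A, \<tau>)|\<^sup>2\<close>. For a fixed \<open>\<tau>\<close>, if \<open>|j(A, \<tau>)|\<close> is comparable to
  \<open>\<parallel>A\<parallel>\<close>, then \<open>A \<tau>\<close> stays in a bounded region and its imaginary part is comparable to
  \<open>\<parallel>A\<parallel>\<close> to the power \<open>-2\<close>; so each of the two growth hypotheses yields that
  \<open>\<parallel>\<rho>(\<gamma>) X(\<tau>)\<parallel>\<close> is at most a constant times \<open>\<parallel>A\<parallel>\<close> to the power \<open>s\<close>
  (\<open>transported_vector_bound\<close>).

  In general \<open>|j(A, \<tau>)|\<close> can be much smaller than \<open>\<parallel>A\<parallel>\<close>, since it sees only the second row of
  \<open>A\<close>. But if \<open>A0\<close> represents an element of \<open>G\<close> that does not fix the point at infinity, then the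
  second row of \<open>A0 A\<close> involves the first row of \<open>A\<close>, and one of \<open>|j(A, \<tau>)|\<close>, \<open>|j(A0 A, \<tau>)|\<close> is
  comparable to \<open>\<parallel>A\<parallel>\<close> (\<open>norm_le_automorphy_factors\<close>). Passing from \<open>\<gamma>\<close> to \<open>g0 \<gamma>\<close> changes
  \<open>\<rho>(\<gamma>) X(\<tau>)\<close> by a fixed invertible matrix. Hence the bound with exponent \<open>s\<close> holds for all
  \<open>\<gamma>\<close>, whatever the sign of \<open>s\<close>, and under both growth hypotheses
  (\<open>representation_growth_on_values\<close>). As \<open>\<parallel>A\<parallel>\<close> to the power \<open>s\<close> is the term \<open>j = 0\<close> of the
  maximum in (b), this one bound serves all parts.

  That some element of \<open>G\<close> moves the point at infinity is where the finite area enters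
  (\<open>first_kind_moves_infinity\<close>). Otherwise \<open>G\<close> acts by affine maps \<open>z \<mapsto> l * z + t\<close>, discretely.
  Such a group consists of translations or of dilations about one point, so it has an interval
  on the real line that is disjoint from its translates. The vertical strip over that interval has
  infinite area and is disjoint from its translates as well, so no fundamental domain has finite area.

  The vectors \<open>v\<close> for which \<open>\<rho>(\<gamma>) v\<close> satisfies the bound form a subspace, which contains the span
  of the values of \<open>X\<close>. That span is invariant and nonzero. If \<open>\<rho>\<close> is irreducible, it is
  everything, and the bound for the standard basis is a bound for \<open>\<rho>(\<gamma>)\<close>. In general a minimal
  nonzero invariant subspace of the span is an irreducible constituent with the required growth.
\<close>

\<comment> \<open>From here on the infix symbol means components of vectors only, not coefficients of power series;
  with both meanings, formulas in several matrix entries have exponentially many parses.\<close>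
no_notation fps_nth (infixl "$" 75)

section \<open>Discrete groups of affine maps and hyperbolic area\<close>

text \<open>The pair \<open>(l, t)\<close> stands for the map \<open>z \<mapsto> l * z + t\<close>.\<close>
definition affine_group :: "(real \<times> real) set \<Rightarrow> bool" where
  "affine_group S \<longleftrightarrow> (1, 0) \<in> S \<and> (\<forall>(l, t)\<in>S. 0 < l \<and> (1 / l, - t / l) \<in> S) \<and>
     (\<forall>(l, t)\<in>S. \<forall>(l', t')\<in>S. (l * l', l * t' + t) \<in> S)"

text \<open>If an affine map does not fix the fixed point of a contraction, then the two generate arbitrarily
  short translations: their commutator is a nontrivial translation, and conjugating it by powers of
  the contraction shrinks it. The conclusion, written without division, says that
  \<open>(l, t)\<close> fixes the fixed point \<open>t0 / (1 - l0)\<close> of \<open>(l0, t0)\<close>.\<close>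
lemma discrete_affine_group_fixes_point:
  assumes S: "affine_group S" and "0 < e"
    and discrete: "\<And>l t. (l, t) \<in> S \<Longrightarrow> \<bar>l - 1\<bar> < e \<Longrightarrow> \<bar>t\<bar> < e \<Longrightarrow> l = 1 \<and> t = 0"
    and s0: "(l0, t0) \<in> S" "l0 \<noteq> 1" and s: "(l, t) \<in> S"
  shows "(1 - l0) * t = (1 - l) * t0"
proof -
  have inv: "0 < l" "(1 / l, - t / l) \<in> S" if "(l, t) \<in> S" for l t
    using S that unfolding affine_group_def by auto
  have comp: "(l * l', l * t' + t) \<in> S" if "(l, t) \<in> S" "(l', t') \<in> S" for l t l' t'
    using S that unfolding affine_group_def by auto
  have contracting: "(1 - l1) * t = (1 - l) * t1"
    if s1: "(l1, t1) \<in> S" "l1 < 1" for l1 t1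
  proof -
    \<comment> \<open>the commutator of \<open>(l, t)\<close> and \<open>(l1, t1)\<close> is the translation by \<open>u\<close>\<close>
    define u where "u = (1 - l1) * t - (1 - l) * t1"
    have "l1 > 0" "l > 0" using inv s s1 by auto
    have "(l * l1 * (1 / (l1 * l)), l * l1 * (- (l1 * t + t1) / (l1 * l)) + (l * t1 + t)) = (1, u)"
      using \<open>l1 > 0\<close> \<open>l > 0\<close> by (simp add: u_def field_simps)
    then have "(1, u) \<in> S"
      using comp[OF comp[OF s s1(1)] inv(2)[OF comp[OF s1(1) s]]] by (simp only:)
    have "(1, l1 ^ n * u) \<in> S" for n
    proof (induction n)
      case (Suc n)
      show ?case
        using comp[OF comp[OF s1(1) Suc] inv(2)[OF s1(1)]] \<open>l1 > 0\<close>
        by (simp add: field_simps)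
    qed (use \<open>(1, u) \<in> S\<close> in simp)
    moreover have "(\<lambda>n. l1 ^ n * u) \<longlonglongrightarrow> 0 * u"
      by (intro tendsto_intros LIMSEQ_realpow_zero) (use \<open>l1 > 0\<close> s1 in auto)
    then have "(\<lambda>n. \<bar>l1 ^ n * u\<bar>) \<longlonglongrightarrow> 0" by (simp add: tendsto_rabs_zero_iff)
    then have "eventually (\<lambda>n. \<bar>l1 ^ n * u\<bar> < e) sequentially"
      using \<open>0 < e\<close> by (rule order_tendstoD)
    then obtain n where "\<bar>l1 ^ n * u\<bar> < e" using eventually_happens by force
    ultimately have "l1 ^ n * u = 0" using discrete[of 1 "l1 ^ n * u"] \<open>0 < e\<close> by auto
    then show ?thesis using \<open>l1 > 0\<close> by (simp add: u_def)
  qed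
  show ?thesis
  proof (cases "l0 < 1")
    case False
    \<comment> \<open>an expanding map is replaced by its inverse\<close>
    then have "1 < l0" using s0 by simp
    have "(1 - 1 / l0) * t = (1 - l) * (- t0 / l0)"
      using \<open>1 < l0\<close> by (intro contracting inv(2) s0) simp
    then have "l0 * ((1 - 1 / l0) * t) = l0 * ((1 - l) * (- t0 / l0))" by simp
    moreover have "l0 * ((1 - 1 / l0) * t) = - ((1 - l0) * t)"
      "l0 * ((1 - l) * (- t0 / l0)) = - ((1 - l) * t0)"
      using \<open>1 < l0\<close> by (simp_all add: field_simps)
    ultimately show ?thesis by simp
  qed (use contracting s0 in blast)
qed

text \<open>A discrete group of affine maps of the line is either a group of translations, and any interval
  shorter than the smallest translation is disjoint from its translates, or a group of dilations
  about one point \<open>p\<close>; then an interval that starts at distance \<open>1\<close> from \<open>p\<close> and is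
  shorter than the gap between the dilation factors and \<open>1\<close> works.\<close>
lemma discrete_affine_group_wandering_interval:
  assumes S: "affine_group S" and e: "0 < e"
    and discrete: "\<And>l t. (l, t) \<in> S \<Longrightarrow> \<bar>l - 1\<bar> < e \<Longrightarrow> \<bar>t\<bar> < e \<Longrightarrow> l = 1 \<and> t = 0"
  obtains a b where "a < b"
    "\<And>l t x. (l, t) \<in> S \<Longrightarrow> a < x \<Longrightarrow> x < b \<Longrightarrow> a < l * x + t \<Longrightarrow> l * x + t < b \<Longrightarrow> l = 1 \<and> t = 0"
proof (cases "\<exists>(l, t)\<in>S. l \<noteq> 1")
  case False
  show ?thesis
  proof (rule that[of 0 e])
    fix l t x
    assume "(l, t) \<in> S" "0 < x" "x < e" "0 < l * x + t" "l * x + t < e"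
    moreover from this have "l = 1" using False by auto
    ultimately show "l = 1 \<and> t = 0" using discrete[of l t] e by auto
  qed (rule e)
next
  case True
  then obtain l0 t0 where s0: "(l0, t0) \<in> S" "l0 \<noteq> 1" by auto
  define p where "p = t0 / (1 - l0)"
  have fixp: "t = (1 - l) * p" if "(l, t) \<in> S" for l t
    using discrete_affine_group_fixes_point[OF S e discrete s0 that] s0(2)
    by (simp add: p_def field_simps)
  \<comment> \<open>chosen such that a factor within \<open>h\<close> of \<open>1\<close> forces \<open>\<bar>t\<bar> = \<bar>l - 1\<bar> * \<bar>p\<bar> < e\<close> too\<close>
  define h where "h = e / (1 + \<bar>p\<bar>)"
  have "h > 0" "h * (1 + \<bar>p\<bar>) = e" using e by (auto simp: h_def)
  then have "h + h * \<bar>p\<bar> = e" "h * \<bar>p\<bar> \<ge> 0" by (auto simp: algebra_simps)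
  have gap: "h \<le> \<bar>l - 1\<bar>" if "(l, t) \<in> S" "l \<noteq> 1" for l t
  proof (rule ccontr)
    assume less: "\<not> h \<le> \<bar>l - 1\<bar>"
    have "\<bar>t\<bar> = \<bar>l - 1\<bar> * \<bar>p\<bar>" using fixp[OF that(1)] by (simp add: abs_mult abs_minus_commute)
    also have "\<dots> \<le> h * \<bar>p\<bar>" using less by (intro mult_right_mono) auto
    finally have "\<bar>t\<bar> < e" "\<bar>l - 1\<bar> < e"
      using less \<open>h + h * \<bar>p\<bar> = e\<close> \<open>h > 0\<close> \<open>h * \<bar>p\<bar> \<ge> 0\<close> by auto
    then show False using discrete that by blast
  qed
  show ?thesis
  proof (rule that[of "p + 1" "p + 1 + h"])
    fix l t x
    assume s: "(l, t) \<in> S" and x: "p + 1 < x" "x < p + 1 + h"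
      and y: "p + 1 < l * x + t" "l * x + t < p + 1 + h"
    define r where "r = x - p"
    have r: "1 < r" "r < 1 + h" "1 < l * r" "l * r < 1 + h"
      using x y fixp[OF s] by (auto simp: r_def algebra_simps)
    have "l > 0" using S s unfolding affine_group_def by auto
    have "l = 1"
    proof (rule ccontr)
      assume "l \<noteq> 1"
      then have "h \<le> \<bar>l - 1\<bar>" by (rule gap[OF s])
      then consider "1 + h \<le> l" | "l \<le> 1 - h" by linarith
      then show False
      proof cases
        case 1
        then have "l * 1 \<le> l * r" using \<open>l > 0\<close> r by (intro mult_left_mono) auto
        then show False using 1 r by linarith
      next
        case 2
        then have "l * r \<le> (1 - h) * r" using r by (intro mult_right_mono) auto
        also have "\<dots> \<le> (1 - h) * (1 + h)"
          using r 2 \<open>l > 0\<close> by (intro mult_left_mono) auto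
        also have "\<dots> \<le> 1" by (simp add: algebra_simps)
        finally show False using r by simp
      qed
    qed
    then show "l = 1 \<and> t = 0" using fixp[OF s] by simp
  qed (use \<open>h > 0\<close> in simp)
qed

text \<open>The Jacobian \<open>l\<^sup>2\<close> of the affine map cancels against the density \<open>1 / (Im z)\<^sup>2\<close>.\<close>
lemma hyperbolic_area_affine:
  fixes l t :: real
  assumes [measurable]: "A \<in> sets borel" and l: "0 < l"
  shows "hyperbolic_area {z. of_real l * z + of_real t \<in> A} = hyperbolic_area A"
proof -
  have "hyperbolic_area A = (\<integral>\<^sup>+z. ennreal (1 / (Im z)\<^sup>2) * indicator A z \<partial>lborel)"
    unfolding hyperbolic_area_def ..
  also have "\<dots> = (\<integral>\<^sup>+z. ennreal (l\<^sup>2) * (ennreal (1 / (Im (of_real t + l *\<^sub>R z))\<^sup>2) *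
      indicator A (of_real t + l *\<^sub>R z)) \<partial>lborel)"
    using l
    by (subst lborel_affine[of l "of_real t :: complex"])
       (simp_all add: nn_integral_density nn_integral_distr)
  also have "\<dots> = (\<integral>\<^sup>+z. ennreal (1 / (Im z)\<^sup>2) *
      indicator {z. of_real l * z + of_real t \<in> A} z \<partial>lborel)"
  proof (intro nn_integral_cong)
    fix z :: complex
    have "ennreal (l\<^sup>2) * ennreal (1 / (Im (of_real t + l *\<^sub>R z))\<^sup>2) = ennreal (1 / (Im z)\<^sup>2)"
      using l by (subst ennreal_mult[symmetric]) (auto simp: power_mult_distrib)
    moreover have "indicator {z. of_real l * z + of_real t \<in> A} z =
        (indicator A (of_real t + l *\<^sub>R z) :: ennreal)"
      by (simp add: indicator_def scaleR_conv_of_real add.commute)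
    ultimately show "ennreal (l\<^sup>2) * (ennreal (1 / (Im (of_real t + l *\<^sub>R z))\<^sup>2) *
        indicator A (of_real t + l *\<^sub>R z)) = ennreal (1 / (Im z)\<^sup>2) *
      indicator {z. of_real l * z + of_real t \<in> A} z"
      by (simp only: mult.assoc[symmetric])
  qed
  finally show ?thesis unfolding hyperbolic_area_def by simp
qed

text \<open>The density is at least \<open>n\<^sup>2\<close> on the part of height \<open>1 / n\<close>, so that this part alone
  contributes \<open>n * (b - a)\<close>.\<close>
lemma hyperbolic_area_vertical_strip:
  assumes "a < b"
  shows "hyperbolic_area {z. 0 < Im z \<and> a < Re z \<and> Re z < b} = \<infinity>" (is "hyperbolic_area ?E = _")
proof -
  have le: "ennreal (real n * (b - a)) \<le> hyperbolic_area ?E" if "n > 0" for n :: nat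
  proof -
    let ?B = "box (Complex a 0) (Complex b (1 / n))"
    have B: "z \<in> ?B \<longleftrightarrow> a < Re z \<and> Re z < b \<and> 0 < Im z \<and> Im z < 1 / n" for z
      by (auto simp: box_def Basis_complex_def)
    have "emeasure lborel ?B = ennreal ((b - a) * (1 / n))"
      using assms by (subst emeasure_lborel_box) (auto simp: Basis_complex_def inner_complex_def)
    then have "ennreal (real n * (b - a)) = (\<integral>\<^sup>+z. ennreal ((real n)\<^sup>2) * indicator ?B z \<partial>lborel)"
      using that assms
      by (simp add: nn_integral_cmult_indicator power2_eq_square flip: ennreal_mult)
    also have "\<dots> \<le> hyperbolic_area ?E"
      unfolding hyperbolic_area_def
    proof (intro nn_integral_mono)
      fix z
      show "ennreal ((real n)\<^sup>2) * indicator ?B z \<le> ennreal (1 / (Im z)\<^sup>2) * indicator ?E z"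
      proof (cases "z \<in> ?B")
        case True
        then have "(Im z)\<^sup>2 \<le> (1 / n)\<^sup>2" "0 < Im z" unfolding B by (auto intro!: power_mono)
        then have "(real n)\<^sup>2 \<le> 1 / (Im z)\<^sup>2" using that by (auto simp: field_simps)
        then have "ennreal ((real n)\<^sup>2) \<le> ennreal (1 / (Im z)\<^sup>2)" by (rule ennreal_leI)
        then show ?thesis using True unfolding B by (simp add: indicator_def B)
      qed simp
    qed
    finally show ?thesis .
  qed
  show ?thesis
  proof (rule ccontr)
    assume "hyperbolic_area ?E \<noteq> \<infinity>"
    then obtain r where r: "hyperbolic_area ?E = ennreal r" "r \<ge> 0"
      by (cases "hyperbolic_area ?E") auto
    obtain n :: nat where n: "r / (b - a) < n" using reals_Archimedean2 by blast
    moreover have "0 \<le> r / (b - a)" using r assms by simp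
    ultimately have "n > 0" by (metis gr0I less_le_not_le of_nat_0)
    then have "real n * (b - a) \<le> r" using le[of n] r by (simp add: ennreal_le_iff)
    then show False using n assms by (simp add: field_simps)
  qed
qed

text \<open>A set \<open>E\<close> that is cut into pieces by the images of \<open>F\<close> can be moved into \<open>F\<close> piece by
  piece without changing areas. If the preimages of \<open>E\<close> are pairwise disjoint, then so are the
  moved pieces.\<close>
lemma hyperbolic_area_disjoint_pieces_le:
  assumes [simp]: "countable S" and pos: "\<And>l t. (l, t) \<in> S \<Longrightarrow> 0 < l"
    and [measurable]: "E \<in> sets borel" "F \<in> sets borel"
    and cover: "\<And>z. z \<in> E \<Longrightarrow> \<exists>(l, t)\<in>S. \<exists>w\<in>F. z = of_real l * w + of_real t"
    and disj: "disjoint_family_on (\<lambda>(l, t). {w. of_real l * w + of_real t \<in> E}) S"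
  shows "hyperbolic_area E \<le> hyperbolic_area F"
proof -
  define T :: "real \<times> real \<Rightarrow> complex \<Rightarrow> complex" where
    "T s w = of_real (fst s) * w + of_real (snd s)" for s w
  define P where "P s = {z \<in> E. (z - of_real (snd s)) / of_real (fst s) \<in> F}" for s
  have [measurable]: "T s \<in> borel_measurable borel" for s unfolding T_def by measurable
  have [measurable]: "P s \<in> sets borel" for s unfolding P_def by measurable
  define M where "M = density lborel (\<lambda>z::complex. ennreal (1 / (Im z)\<^sup>2))"
  have area: "hyperbolic_area A = emeasure M A" if "A \<in> sets borel" for A
    using that unfolding hyperbolic_area_def M_def by (simp add: emeasure_density)
  have [measurable_cong]: "sets M = sets borel" by (simp add: M_def)
  have "emeasure M E = (\<integral>\<^sup>+z. indicator E z \<partial>M)" by simp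
  also have "\<dots> \<le> (\<integral>\<^sup>+z. \<integral>\<^sup>+s. indicator (P s) z \<partial>count_space S \<partial>M)"
  proof (intro nn_integral_mono)
    fix z
    show "indicator E z \<le> (\<integral>\<^sup>+s. indicator (P s) z \<partial>count_space S)"
    proof (cases "z \<in> E")
      case True
      then obtain l t w where s: "(l, t) \<in> S" "w \<in> F" "z = of_real l * w + of_real t"
        using cover by blast
      then have "z \<in> P (l, t)" using pos[OF s(1)] True by (auto simp: P_def)
      then have "(1::ennreal) = (\<integral>\<^sup>+s. indicator {(l, t)} s \<partial>count_space S)"
        using s by simp
      also have "\<dots> \<le> (\<integral>\<^sup>+s. indicator (P s) z \<partial>count_space S)"
        using \<open>z \<in> P (l, t)\<close> by (intro nn_integral_mono) (auto simp: indicator_def)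
      finally show ?thesis using True by simp
    qed simp
  qed
  also have "\<dots> = (\<integral>\<^sup>+s. emeasure M (P s) \<partial>count_space S)"
    by (subst nn_integral_count_space_nn_integral) auto
  also have "\<dots> = (\<integral>\<^sup>+s. emeasure M ({w. T s w \<in> E} \<inter> F) \<partial>count_space S)"
  proof (intro nn_integral_cong)
    fix s assume "s \<in> space (count_space S)"
    then have pos': "0 < fst s" using pos[of "fst s" "snd s"] by simp
    have "{w. T s w \<in> P s} = {w. T s w \<in> E} \<inter> F"
      using pos' by (auto simp: P_def T_def)
    then show "emeasure M (P s) = emeasure M ({w. T s w \<in> E} \<inter> F)"
      using hyperbolic_area_affine[OF _ pos', of "P s" "snd s"]
      by (simp add: T_def flip: area)
  qed
  also have "\<dots> = emeasure M (\<Union>s\<in>S. {w. T s w \<in> E} \<inter> F)"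
  proof (rule emeasure_UN_countable[symmetric])
    show "disjoint_family_on (\<lambda>s. {w. T s w \<in> E} \<inter> F) S"
      using disj unfolding disjoint_family_on_def T_def case_prod_beta by blast
  qed auto
  also have "\<dots> \<le> emeasure M F" by (intro emeasure_mono) auto
  finally show ?thesis by (simp add: area)
qed

text \<open>The maps act on real parts alone. Hence the vertical strip over a wandering interval is disjoint
  from its translates, while its area is infinite.\<close>
lemma discrete_affine_group_infinite_area:
  assumes S: "affine_group S" and e: "0 < e"
    and discrete: "\<And>l t. (l, t) \<in> S \<Longrightarrow> \<bar>l - 1\<bar> < e \<Longrightarrow> \<bar>t\<bar> < e \<Longrightarrow> l = 1 \<and> t = 0"
    and F: "F \<in> sets borel"
    and cover: "\<And>z. 0 < Im z \<Longrightarrow> \<exists>(l, t)\<in>S. \<exists>w\<in>F. z = of_real l * w + of_real t"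
  shows "hyperbolic_area F = \<infinity>"
proof -
  obtain a b where ab: "a < b"
    and wandering: "\<And>l t x. (l, t) \<in> S \<Longrightarrow> a < x \<Longrightarrow> x < b \<Longrightarrow> a < l * x + t \<Longrightarrow>
      l * x + t < b \<Longrightarrow> l = 1 \<and> t = 0"
    by (rule discrete_affine_group_wandering_interval[OF S e]) (use discrete in blast)+
  have inv: "0 < l" "(1 / l, - t / l) \<in> S" if "(l, t) \<in> S" for l t
    using S that unfolding affine_group_def by auto
  have comp: "(l * l', l * t' + t) \<in> S" if "(l, t) \<in> S" "(l', t') \<in> S" for l t l' t'
    using S that unfolding affine_group_def by auto
  have eq: "(l, t) = (l', t')"
    if s: "(l, t) \<in> S" "(l', t') \<in> S" and x: "a < l * x + t" "l * x + t < b"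
      "a < l' * x + t'" "l' * x + t' < b" for l t l' t' x
  proof -
    have "l > 0" "l' > 0" using inv s by auto
    have "(l' / l) * (l * x + t) + (t' - l' * t / l) = l' * x + t'"
      using \<open>l > 0\<close> by (simp add: field_simps)
    moreover have "(l' / l, t' - l' * t / l) \<in> S"
      using comp[OF s(2) inv(2)[OF s(1)]] by simp
    ultimately have "l' / l = 1 \<and> t' - l' * t / l = 0"
      using x by (intro wandering[of _ _ "l * x + t"]) auto
    moreover from this have "l' = l" using \<open>l > 0\<close> by (simp add: field_simps)
    ultimately show ?thesis using \<open>l > 0\<close> by simp
  qed
  \<comment> \<open>the preimages of the interval are pairwise disjoint open sets, so there are countably many of them\<close>
  define J where "J = (\<lambda>(l, t). {x. a < l * x + t \<and> l * x + t < b})"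
  have "countable (J ` S)"
  proof (rule countable_disjoint_open_subsets)
    fix A assume "A \<in> J ` S"
    then show "open A"
      by (auto simp: J_def intro!: open_Collect_conj open_Collect_less continuous_intros)
  next
    show "pairwise disjnt (J ` S)"
      using eq unfolding pairwise_def disjnt_def J_def by fast
  qed
  moreover have "inj_on J S"
  proof (rule inj_onI)
    fix s s' assume s: "s \<in> S" "s' \<in> S" "J s = J s'"
    obtain l t l' t' where lt: "s = (l, t)" "s' = (l', t')" by (cases s, cases s')
    define x where "x = ((a + b) / 2 - t) / l"
    have "l * x + t = (a + b) / 2" using inv(1)[of l t] s lt by (simp add: x_def)
    then have "a < l * x + t" "l * x + t < b" using ab by auto
    moreover from this have "x \<in> J s'" unfolding s(3)[symmetric] by (simp add: J_def lt)
    ultimately show "s = s'" using s eq[of l t l' t' x] by (auto simp: J_def lt)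
  qed
  ultimately have "countable S" by (rule countable_image_inj_on)
  let ?E = "{z. 0 < Im z \<and> a < Re z \<and> Re z < b}"
  have "hyperbolic_area ?E \<le> hyperbolic_area F"
  proof (rule hyperbolic_area_disjoint_pieces_le[OF \<open>countable S\<close> inv(1) _ F])
    show "?E \<in> sets borel" by measurable
    show "disjoint_family_on (\<lambda>(l, t). {w. of_real l * w + of_real t \<in> ?E}) S"
      using eq unfolding disjoint_family_on_def by fastforce
  qed (use cover in auto)
  then show ?thesis using hyperbolic_area_vertical_strip[OF ab] by (simp add: top_unique)
qed

section \<open>Groups of the first kind move the point at infinity\<close>

lemma PSL2R_class:
  assumes "\<gamma> \<in> carrier PSL2R" "A \<in> \<gamma>"
  shows "det A = 1" "\<gamma> = {A, - A}"
  using assms by (auto simp: carrier_PSL2R det_uminus_2)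

lemma PSL2R_mult:
  assumes "A \<in> \<gamma>" "B \<in> \<delta>"
  shows "A ** B \<in> \<gamma> \<otimes>\<^bsub>PSL2R\<^esub> \<delta>"
  using assms by (auto simp: PSL2R_def FactGroup_def set_mult_def SL2R_def)

lemma PSL2R_one: "\<one>\<^bsub>PSL2R\<^esub> = {mat 1, - mat 1}"
  by (simp add: PSL2R_def FactGroup_def)

lemma matrix_mult_2:
  "((A :: real^2^2) ** B) $ i $ j = A $ i $ 1 * B $ 1 $ j + A $ i $ 2 * B $ 2 $ j"
  by (simp add: matrix_matrix_mult_def sum_2)

text \<open>A matrix with rows \<open>(a, b)\<close> and \<open>(0, 1 / a)\<close> acts as \<open>z \<mapsto> a\<^sup>2 * z + a * b\<close>.\<close>
lemma affine_group_of_upper_triangular: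
  fixes G :: "(real^2^2) set set"
  assumes G: "subgroup G PSL2R" and upper: "\<And>\<gamma> (A :: real^2^2). \<gamma> \<in> G \<Longrightarrow> A \<in> \<gamma> \<Longrightarrow> A $ 2 $ 1 = 0"
  shows "affine_group {((A $ 1 $ 1)\<^sup>2, A $ 1 $ 1 * A $ 1 $ 2) | (A :: real^2^2) \<gamma>. \<gamma> \<in> G \<and> A \<in> \<gamma>}"
proof -
  define S where
    "S = {((A $ 1 $ 1)\<^sup>2, A $ 1 $ 1 * A $ 1 $ 2) | (A :: real^2^2) \<gamma>. \<gamma> \<in> G \<and> A \<in> \<gamma>}"
  interpret PSL2R: group PSL2R by (rule group_PSL2R)
  have det: "A $ 1 $ 1 * A $ 2 $ 2 = 1" if "\<gamma> \<in> G" "A \<in> \<gamma>" for \<gamma> and A :: "real^2^2"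
    using PSL2R_class(1)[of \<gamma> A] subgroup.subset[OF G] upper[OF that] that by (auto simp: det_2)
  have "{mat 1, - mat 1} \<in> G" using subgroup.one_closed[OF G] by (simp add: PSL2R_one)
  then have one: "(1, 0) \<in> S"
    unfolding S_def by (intro CollectI exI[of _ "mat 1"] exI[of _ "{mat 1, - mat 1}"]) (simp add: mat_def)
  have inv: "(0 :: real) < (A $ 1 $ 1)\<^sup>2 \<and>
      (1 / (A $ 1 $ 1)\<^sup>2, - (A $ 1 $ 1 * A $ 1 $ 2) / (A $ 1 $ 1)\<^sup>2) \<in> S"
    if A: "\<gamma> \<in> G" "A \<in> \<gamma>" for A :: "real^2^2" and \<gamma>
  proof
    have "A $ 1 $ 1 \<noteq> 0" using det[OF A] by auto
    then show "0 < (A $ 1 $ 1)\<^sup>2" by simp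
    define \<delta> where "\<delta> = inv\<^bsub>PSL2R\<^esub> \<gamma>"
    have \<delta>: "\<delta> \<in> G" unfolding \<delta>_def by (rule subgroup.m_inv_closed[OF G A(1)])
    have "\<gamma> \<in> carrier PSL2R" "\<delta> \<in> carrier PSL2R" using subgroup.subset[OF G] A \<delta> by auto
    from this(2) obtain B where B: "B \<in> \<delta>" by (auto simp: carrier_PSL2R)
    have "\<gamma> \<otimes>\<^bsub>PSL2R\<^esub> \<delta> = {mat 1, - mat 1}"
      unfolding \<delta>_def using \<open>\<gamma> \<in> carrier PSL2R\<close> by (simp add: PSL2R_one)
    then have "A ** B = mat 1 \<or> A ** B = - mat 1"
      using PSL2R_mult[OF A(2) B] by auto
    then have "((A ** B) $ 1 $ 1)\<^sup>2 = 1 \<and> (A ** B) $ 1 $ 2 = 0"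
      by (elim disjE) (simp_all add: mat_def)
    then have AB: "(A $ 1 $ 1 * B $ 1 $ 1)\<^sup>2 = 1" "A $ 1 $ 1 * B $ 1 $ 2 + A $ 1 $ 2 * B $ 2 $ 2 = 0"
      by (simp_all add: matrix_mult_2 upper[OF \<delta> B])
    have "A $ 1 $ 1 * (B $ 1 $ 1 * B $ 1 $ 2) + A $ 1 $ 2 * (B $ 1 $ 1 * B $ 2 $ 2) =
        B $ 1 $ 1 * (A $ 1 $ 1 * B $ 1 $ 2 + A $ 1 $ 2 * B $ 2 $ 2)"
      by (simp only: distrib_left mult_ac)
    also have "\<dots> = 0" unfolding AB(2) by simp
    finally have "A $ 1 $ 1 * (B $ 1 $ 1 * B $ 1 $ 2) + A $ 1 $ 2 * (B $ 1 $ 1 * B $ 2 $ 2) = 0" .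
    then have "A $ 1 $ 1 * (B $ 1 $ 1 * B $ 1 $ 2) = - A $ 1 $ 2"
      unfolding det[OF \<delta> B] by linarith
    then have "B $ 1 $ 1 * B $ 1 $ 2 = - A $ 1 $ 2 / A $ 1 $ 1"
      using \<open>A $ 1 $ 1 \<noteq> 0\<close> by (simp add: field_simps)
    then have "B $ 1 $ 1 * B $ 1 $ 2 = - (A $ 1 $ 1 * A $ 1 $ 2) / (A $ 1 $ 1)\<^sup>2"
      by (simp add: power2_eq_square)
    moreover have "(B $ 1 $ 1)\<^sup>2 = 1 / (A $ 1 $ 1)\<^sup>2"
      using AB(1) \<open>A $ 1 $ 1 \<noteq> 0\<close> by (simp add: eq_divide_eq power_mult_distrib mult.commute)
    ultimately show "(1 / (A $ 1 $ 1)\<^sup>2, - (A $ 1 $ 1 * A $ 1 $ 2) / (A $ 1 $ 1)\<^sup>2) \<in> S"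
      using \<delta> B unfolding S_def mem_Collect_eq by metis
  qed
  have comp: "((A $ 1 $ 1)\<^sup>2 * (B $ 1 $ 1)\<^sup>2, (A $ 1 $ 1)\<^sup>2 * (B $ 1 $ 1 * B $ 1 $ 2) + A $ 1 $ 1 * A $ 1 $ 2) \<in> S"
    if A: "\<gamma> \<in> G" "A \<in> \<gamma>" and B: "\<delta> \<in> G" "B \<in> \<delta>" for A B :: "real^2^2" and \<gamma> \<delta>
  proof -
    have "(A ** B) $ 1 $ 1 = A $ 1 $ 1 * B $ 1 $ 1"
      "(A ** B) $ 1 $ 2 = A $ 1 $ 1 * B $ 1 $ 2 + A $ 1 $ 2 * B $ 2 $ 2"
      using upper[OF B] by (auto simp: matrix_mult_2)
    moreover have "A $ 1 $ 1 * B $ 1 $ 1 * (A $ 1 $ 1 * B $ 1 $ 2 + A $ 1 $ 2 * B $ 2 $ 2) =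
        (A $ 1 $ 1)\<^sup>2 * (B $ 1 $ 1 * B $ 1 $ 2) + A $ 1 $ 1 * A $ 1 $ 2 * (B $ 1 $ 1 * B $ 2 $ 2)"
      by (simp add: algebra_simps power2_eq_square)
    ultimately show ?thesis
      using det[OF B] PSL2R_mult[OF A(2) B(2)] subgroup.m_closed[OF G A(1) B(1)]
      unfolding S_def
      by (intro CollectI exI[of _ "A ** B"] exI[of _ "\<gamma> \<otimes>\<^bsub>PSL2R\<^esub> \<delta>"])
        (simp add: power_mult_distrib)
  qed
  have "affine_group S"
    unfolding affine_group_def
  proof (intro conjI one; clarify)
    fix l t assume "(l, t) \<in> S"
    then obtain A :: "real^2^2" and \<gamma> where A: "\<gamma> \<in> G" "A \<in> \<gamma>" "(l, t) = ((A $ 1 $ 1)\<^sup>2, A $ 1 $ 1 * A $ 1 $ 2)"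
      unfolding S_def by blast
    show "0 < l \<and> (1 / l, - t / l) \<in> S" using inv[OF A(1,2)] A(3) by simp
    fix l' t' assume "(l', t') \<in> S"
    then obtain B :: "real^2^2" and \<delta> where B: "\<delta> \<in> G" "B \<in> \<delta>" "(l', t') = ((B $ 1 $ 1)\<^sup>2, B $ 1 $ 1 * B $ 1 $ 2)"
      unfolding S_def by blast
    show "(l * l', l * t' + t) \<in> S" using comp[OF A(1,2) B(1,2)] A(3) B(3) by simp
  qed
  then show ?thesis unfolding S_def .
qed

lemma moebius_upper_triangular:
  fixes A :: "real^2^2"
  assumes "det A = 1" "A $ 2 $ 1 = 0"
  shows "moebius A z = of_real ((A $ 1 $ 1)\<^sup>2) * z + of_real (A $ 1 $ 1 * A $ 1 $ 2)"
proof -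
  have "A $ 1 $ 1 * A $ 2 $ 2 = 1" using assms by (simp add: det_2)
  then have inv: "of_real (A $ 1 $ 1) * of_real (A $ 2 $ 2) = (1::complex)"
    by (metis of_real_1 of_real_mult)
  then have "of_real (A $ 2 $ 2) \<noteq> (0::complex)" by auto
  with inv show ?thesis
    using assms(2) unfolding moebius_def automorphy_factor_def
    by (simp add: divide_eq_eq power2_eq_square algebra_simps)
qed

text \<open>If every element fixed the point at infinity, the group would act by affine maps. An interior
  point of the fundamental domain shows that this affine group is discrete, and the fundamental domain
  of a discrete affine group has infinite area.\<close>
lemma first_kind_moves_infinity:
  fixes G :: "(real^2^2) set set"
  assumes "Fuchsian_group_first_kind G"
  shows "\<exists>\<gamma>\<in>G. \<exists>A\<in>\<gamma>. A $ 2 $ 1 \<noteq> 0"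
proof (rule ccontr)
  assume "\<not> (\<exists>\<gamma>\<in>G. \<exists>A\<in>\<gamma>. A $ 2 $ 1 \<noteq> 0)"
  then have upper: "A $ 2 $ 1 = 0" if "\<gamma> \<in> G" "A \<in> \<gamma>" for \<gamma> and A :: "real^2^2" using that by blast
  have G: "subgroup G PSL2R"
    using assms by (simp add: Fuchsian_group_first_kind_def Fuchsian_group_def)
  obtain F where F: "fundamental_domain G F" "hyperbolic_area F < \<infinity>"
    using assms by (auto simp: Fuchsian_group_first_kind_def)
  let ?S = "{((A $ 1 $ 1)\<^sup>2, A $ 1 $ 1 * A $ 1 $ 2) | (A :: real^2^2) \<gamma>. \<gamma> \<in> G \<and> A \<in> \<gamma>}"
  have det: "det A = 1" if "\<gamma> \<in> G" "A \<in> \<gamma>" for \<gamma> and A :: "real^2^2"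
    using PSL2R_class(1) subgroup.subset[OF G] that by blast
  have moebius: "moebius A z = of_real ((A $ 1 $ 1)\<^sup>2) * z + of_real (A $ 1 $ 1 * A $ 1 $ 2)"
    if "\<gamma> \<in> G" "A \<in> \<gamma>" for \<gamma> z and A :: "real^2^2"
    by (rule moebius_upper_triangular[OF det[OF that] upper[OF that]])
  have cover: "(\<Union>\<gamma>\<in>G. \<Union>A\<in>\<gamma>. moebius A ` F) = upper_half_plane"
    using F(1) by (simp add: fundamental_domain_def)
  have "\<i> \<in> (\<Union>\<gamma>\<in>G. \<Union>A\<in>\<gamma>. moebius A ` F)" unfolding cover by (simp add: upper_half_plane_def)
  then have "F \<noteq> {}" by auto
  moreover have "F \<subseteq> closure (interior F)" using F(1) by (simp add: fundamental_domain_def)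
  ultimately have "interior F \<noteq> {}" by (metis closure_empty subset_empty)
  then obtain z0 where z0: "z0 \<in> interior F" by auto
  then obtain r where r: "r > 0" "ball z0 r \<subseteq> interior F"
    using open_contains_ball open_interior by blast
  \<comment> \<open>a map this close to the identity moves \<open>z0\<close> by less than \<open>r\<close>\<close>
  define e where "e = r / (1 + cmod z0)"
  have "1 + cmod z0 > 0" by (rule add_pos_nonneg) auto
  then have e: "e > 0" "e * (1 + cmod z0) = r" using r(1) by (auto simp: e_def)
  have "hyperbolic_area F = \<infinity>"
  proof (rule discrete_affine_group_infinite_area[OF affine_group_of_upper_triangular[OF G upper] e(1)])
    fix l t assume "(l, t) \<in> ?S" and lt: "\<bar>l - 1\<bar> < e" "\<bar>t\<bar> < e"
    then obtain A :: "real^2^2" and \<gamma> where A: "\<gamma> \<in> G" "A \<in> \<gamma>"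
      and l: "l = (A $ 1 $ 1)\<^sup>2" "t = A $ 1 $ 1 * A $ 1 $ 2" by auto
    have "moebius A z0 - z0 = of_real (l - 1) * z0 + of_real t"
      unfolding moebius[OF A] l by (simp add: algebra_simps)
    then have "cmod (moebius A z0 - z0) \<le> \<bar>l - 1\<bar> * cmod z0 + \<bar>t\<bar>"
      by (metis norm_triangle_ineq norm_mult norm_of_real)
    also have "\<dots> < e * cmod z0 + e"
      using lt by (intro add_le_less_mono mult_right_mono) auto
    also have "\<dots> = r" using e(2) by (simp add: algebra_simps)
    finally have "moebius A z0 \<in> interior F"
      using r(2) by (auto simp: dist_norm norm_minus_commute)
    then have "moebius A z0 \<in> interior F \<inter> moebius A ` interior F" using z0 by auto
    then have "interior F \<inter> moebius A ` interior F \<noteq> {}" by blast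
    moreover have "\<forall>\<gamma>\<in>G - {\<one>\<^bsub>PSL2R\<^esub>}. \<forall>A\<in>\<gamma>. interior F \<inter> moebius A ` interior F = {}"
      using F(1) by (simp add: fundamental_domain_def)
    ultimately have "\<gamma> = \<one>\<^bsub>PSL2R\<^esub>" using A by (meson DiffI singletonD)
    then have "A = mat 1 \<or> A = - mat 1" using A(2) by (simp add: PSL2R_one)
    then show "l = 1 \<and> t = 0" unfolding l by (auto simp: mat_def)
  next
    obtain T where "closed T" "F = upper_half_plane \<inter> T"
      using F(1) by (auto simp: fundamental_domain_def closedin_closed)
    moreover have "open upper_half_plane"
      unfolding upper_half_plane_def by (rule open_halfspace_Im_gt)
    ultimately show "F \<in> sets borel" by auto
  next
    fix z :: complex assume "0 < Im z"
    then have "z \<in> (\<Union>\<gamma>\<in>G. \<Union>A\<in>\<gamma>. moebius A ` F)"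
      unfolding cover by (simp add: upper_half_plane_def)
    then obtain \<gamma> w and A :: "real^2^2" where A: "\<gamma> \<in> G" "A \<in> \<gamma>" and w: "w \<in> F" "z = moebius A w" by blast
    then show "\<exists>(l, t)\<in>?S. \<exists>w\<in>F. z = of_real l * w + of_real t"
      using moebius[OF A]
      by (intro bexI[of _ "((A $ 1 $ 1)\<^sup>2, A $ 1 $ 1 * A $ 1 $ 2)"]) auto
  qed
  then show False using F(2) by simp
qed

section \<open>Linear algebra over the complex numbers\<close>

lemma norm_vector_scalar_mult: "norm (c *s (v :: complex^'m)) = cmod c * norm v"
  by (simp add: norm_vec_def norm_mult L2_set_right_distrib)

lemma scaleR_eq_vector_scalar_mult: "r *\<^sub>R (v :: complex^'m) = of_real r *s v"
  by (simp add: vec_eq_iff scaleR_conv_of_real[where 'a = complex])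

lemma matrix_vector_mult_bounded:
  fixes M :: "complex^'m^'m"
  obtains D where "D > 0" "\<And>v. norm (M *v v) \<le> D * norm v"
proof -
  have "linear (\<lambda>v. M *v v)"
    by (rule linearI) (simp_all add: vec.add vec.scale scaleR_eq_vector_scalar_mult)
  then show ?thesis using linear_bounded_pos that by blast
qed

lemma norm_le_sum_cmod_entries:
  fixes M :: "'a::real_normed_vector^'m^'n"
  shows "norm M \<le> (\<Sum>i\<in>UNIV. \<Sum>j\<in>UNIV. norm (M $ i $ j))"
proof -
  have "norm M \<le> (\<Sum>i\<in>UNIV. norm (M $ i))"
    unfolding norm_vec_def by (rule L2_set_le_sum) simp
  also have "\<dots> \<le> (\<Sum>i\<in>UNIV. \<Sum>j\<in>UNIV. norm (M $ i $ j))"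
    unfolding norm_vec_def by (intro sum_mono L2_set_le_sum) simp
  finally show ?thesis .
qed

lemma norm_matrix_le_sum_columns:
  fixes M :: "complex^'m^'m"
  shows "norm M \<le> CARD('m) * (\<Sum>j\<in>UNIV. norm (M *v axis j 1))"
proof -
  have "norm M \<le> (\<Sum>i\<in>UNIV. \<Sum>j\<in>UNIV. norm (M $ i $ j))"
    by (rule norm_le_sum_cmod_entries)
  also have "\<dots> \<le> (\<Sum>i\<in>(UNIV :: 'm set). \<Sum>j\<in>UNIV. norm (M *v axis j 1))"
  proof (intro sum_mono)
    fix i j
    have "norm (M $ i $ j) = norm ((M *v axis j 1) $ i)"
      by (simp add: matrix_vector_mult_def axis_def if_distrib[of "\<lambda>x. _ * x"] cong: if_cong)
    also have "\<dots> \<le> norm (M *v axis j 1)" by (rule Finite_Cartesian_Product.norm_nth_le)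
    finally show "norm (M $ i $ j) \<le> norm (M *v axis j 1)" .
  qed
  finally show ?thesis by simp
qed

lemma entries_norm_le:
  assumes "\<And>i j. i < n \<Longrightarrow> j < n \<Longrightarrow> cmod (M i j) \<le> r" "0 \<le> r"
  shows "entries_norm n M \<le> n * r"
proof -
  have "(\<Sum>i<n. \<Sum>j<n. (cmod (M i j))\<^sup>2) \<le> (\<Sum>i<n. \<Sum>j<n. r\<^sup>2)"
    using assms by (intro sum_mono power_mono) auto
  also have "\<dots> = (n * r)\<^sup>2" by (simp add: power2_eq_square)
  finally show ?thesis
    unfolding entries_norm_def using assms(2) by (intro real_le_lsqrt) (auto intro: sum_nonneg)
qed

text \<open>The coordinates with respect to \<open>B\<close> are extended linearly to the whole space, where linear maps
  are bounded.\<close>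
lemma coordinate_functionals:
  fixes B :: "(complex^'m) set"
  assumes "vec.independent B"
  obtains f :: "complex^'m \<Rightarrow> complex^'m \<Rightarrow> complex" and D :: real
  where "D > 0" "\<And>b v. b \<in> B \<Longrightarrow> cmod (f b v) \<le> D * norm v"
    "\<And>v. v \<in> vec.span B \<Longrightarrow> v = (\<Sum>b\<in>B. f b v *s b)"
proof -
  have fin: "finite B" using assms by (rule vec.finiteI_independent)
  define E where "E = vec.extend_basis B"
  have E: "B \<subseteq> E" "vec.independent E" "vec.span E = UNIV"
    unfolding E_def by (rule vec.extend_basis_superset[OF assms] vec.independent_extend_basis[OF assms]
      vec.span_extend_basis[OF assms])+
  define f where "f b v = vec.representation E v b" for b v
  have "\<exists>D>0. \<forall>v. cmod (f b v) \<le> D * norm v" for b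
  proof -
    have "linear (f b)"
      using E by (intro linearI)
        (simp_all add: f_def vec.representation_add vec.representation_scale
          scaleR_eq_vector_scalar_mult scaleR_conv_of_real)
    then show ?thesis using linear_bounded_pos by metis
  qed
  then obtain d where d: "\<And>b. d b > 0" "\<And>b v. cmod (f b v) \<le> d b * norm v" by metis
  show ?thesis
  proof (rule that[of "1 + sum d B" f])
    show "1 + sum d B > 0" using d(1) by (intro add_pos_nonneg sum_nonneg) (auto simp: less_imp_le)
    fix b v assume "b \<in> B"
    then have "d b \<le> 1 + sum d B"
      using member_le_sum[of b B d] fin d(1) by (simp add: less_imp_le add_increasing)
    then show "cmod (f b v) \<le> (1 + sum d B) * norm v"
      using d(2)[of b v] by (meson mult_right_mono norm_ge_zero order_trans)
  next
    fix v assume v: "v \<in> vec.span B"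
    have "f b v = vec.representation B v b" for b
      unfolding f_def using vec.representation_extend[OF E(2) v E(1)] by simp
    then show "v = (\<Sum>b\<in>B. f b v *s b)"
      using vec.sum_representation_eq[OF assms v fin order_refl] by simp
  qed
qed

lemma minimal_invariant_subspace:
  fixes \<rho> :: "'g \<Rightarrow> complex^'m^'m"
  assumes "invariant_subspace \<Gamma> \<rho> W" "W \<noteq> {0}"
  obtains V where "invariant_subspace \<Gamma> \<rho> V" "V \<subseteq> W" "V \<noteq> {0}"
    "\<And>U. invariant_subspace \<Gamma> \<rho> U \<Longrightarrow> U \<subseteq> V \<Longrightarrow> U = {0} \<or> U = V"
proof -
  define P where "P V \<longleftrightarrow> invariant_subspace \<Gamma> \<rho> V \<and> V \<subseteq> W \<and> V \<noteq> {0}" for V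
  obtain V where V: "P V" and min: "\<And>U. P U \<Longrightarrow> vec.dim V \<le> vec.dim U"
    using ex_has_least_nat[of P W vec.dim] assms by (auto simp: P_def)
  show ?thesis
  proof (rule that)
    fix U assume U: "invariant_subspace \<Gamma> \<rho> U" "U \<subseteq> V"
    show "U = {0} \<or> U = V"
    proof (cases "U = {0}")
      case False
      then have "P U" using U V by (auto simp: P_def)
      then have "U = V"
        using U V min by (intro vec.subspace_dim_equal) (auto simp: P_def invariant_subspace_def)
      then show ?thesis ..
    qed simp
  qed (use V in \<open>auto simp: P_def\<close>)
qed

text \<open>A minimal nonzero invariant subspace \<open>V\<close> of \<open>W\<close> gives the constituent \<open>V / {0}\<close>. Its
  matrices have the coordinates of the images of basis vectors as entries, and so are controlled by the
  action on finitely many vectors of \<open>W\<close>.\<close>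
lemma irreducible_constituent_of_subspace:
  fixes \<rho> :: "'g \<Rightarrow> complex^'m^'m"
  assumes W: "invariant_subspace \<Gamma> \<rho> W" "W \<noteq> {0}"
  obtains n \<sigma> w D where "irreducible_constituent \<Gamma> \<rho> n \<sigma>" "\<And>j. j < n \<Longrightarrow> w j \<in> W" "0 < D"
    "\<And>g. g \<in> carrier \<Gamma> \<Longrightarrow> entries_norm n (\<sigma> g) \<le> D * (\<Sum>j<n. norm (\<rho> g *v w j))"
proof -
  obtain V where V: "invariant_subspace \<Gamma> \<rho> V" "V \<subseteq> W" "V \<noteq> {0}"
    and min: "\<And>U. invariant_subspace \<Gamma> \<rho> U \<Longrightarrow> U \<subseteq> V \<Longrightarrow> U = {0} \<or> U = V"
    by (rule minimal_invariant_subspace[OF W]) blast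
  have sub: "vec.subspace V" and inv: "\<And>g v. g \<in> carrier \<Gamma> \<Longrightarrow> v \<in> V \<Longrightarrow> \<rho> g *v v \<in> V"
    using V(1) by (auto simp: invariant_subspace_def)
  obtain B where B: "B \<subseteq> V" "vec.independent B" "V \<subseteq> vec.span B"
    using vec.maximal_independent_subset by blast
  have span: "vec.span B = V" using B sub by (simp add: vec.span_minimal subset_antisym)
  have fin: "finite B" using B(2) by (rule vec.finiteI_independent)
  obtain f :: "complex^'m \<Rightarrow> complex^'m \<Rightarrow> complex" and D :: real
    where D: "D > 0" "\<And>b v. b \<in> B \<Longrightarrow> cmod (f b v) \<le> D * norm v"
      and f: "\<And>v. v \<in> vec.span B \<Longrightarrow> v = (\<Sum>b\<in>B. f b v *s b)"
    by (rule coordinate_functionals[OF B(2)]) blast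
  define n where "n = card B"
  obtain w where w: "bij_betw w {..<n} B"
    using ex_bij_betw_nat_finite[OF fin] by (auto simp: n_def atLeast0LessThan)
  have wB: "w i \<in> B" if "i < n" for i using w that by (auto simp: bij_betw_def)
  have f_w: "v = (\<Sum>i<n. f (w i) v *s w i)" if "v \<in> V" for v
    using f[of v] that unfolding span
    by (simp add: sum.reindex_bij_betw[OF w, of "\<lambda>b. f b v *s b"])
  define \<sigma> where "\<sigma> g i j = f (w i) (\<rho> g *v w j)" for g i j
  have zero: "invariant_subspace \<Gamma> \<rho> {0}"
    by (simp add: invariant_subspace_def vec.subspace_single_0)
  have "basis_modulo {0} V n w"
    unfolding basis_modulo_def
  proof (intro conjI allI ballI impI)
    fix i assume "i < n"
    then show "w i \<in> V" using wB B by auto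
  next
    fix v assume "v \<in> V"
    then show "\<exists>c. v - (\<Sum>i<n. c i *s w i) \<in> {0}"
      using f_w by (intro exI[of _ "\<lambda>i. f (w i) v"]) simp
  next
    fix c i assume c: "(\<Sum>i<n. c i *s w i) \<in> {0}" and i: "i < n"
    \<comment> \<open>the coefficients reindexed by the basis vectors\<close>
    define c' where "c' b = c (inv_into {..<n} w b)" for b
    have c': "c' (w i) = c i" if "i < n" for i
      using w that by (simp add: c'_def bij_betw_def inv_into_f_f)
    have "(\<Sum>b\<in>B. c' b *s b) = (\<Sum>i<n. c' (w i) *s w i)"
      by (rule sum.reindex_bij_betw[OF w, symmetric])
    also have "\<dots> = 0" using c by (simp add: c')
    finally have "c' (w i) = 0"
      using vec.independentD[OF B(2) fin order_refl] wB[OF i] by blast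
    then show "c i = 0" using c'[OF i] by simp
  qed
  moreover have "\<rho> g *v w j - (\<Sum>i<n. \<sigma> g i j *s w i) \<in> {0}" if "g \<in> carrier \<Gamma>" "j < n" for g j
    using f_w[OF inv[OF that(1), of "w j"]] wB[OF that(2)] B(1) unfolding \<sigma>_def by auto
  ultimately have irr: "irreducible_constituent \<Gamma> \<rho> n \<sigma>"
    unfolding irreducible_constituent_def
    using zero V(1,3) min vec.subspace_0[OF sub]
    by (intro exI[of _ "{0}"] exI[of _ V] exI[of _ w]) auto
  have bound: "entries_norm n (\<sigma> g) \<le> (n * D + 1) * (\<Sum>j<n. norm (\<rho> g *v w j))" for g
  proof -
    have nonneg: "0 \<le> (\<Sum>j<n. norm (\<rho> g *v w j))" by (intro sum_nonneg) simp
    have "entries_norm n (\<sigma> g) \<le> n * (D * (\<Sum>j<n. norm (\<rho> g *v w j)))"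
    proof (rule entries_norm_le)
      fix i j assume ij: "i < n" "j < n"
      have "cmod (\<sigma> g i j) \<le> D * norm (\<rho> g *v w j)"
        unfolding \<sigma>_def using D(2) wB ij by blast
      also have "\<dots> \<le> D * (\<Sum>j<n. norm (\<rho> g *v w j))"
        using ij D(1) by (intro mult_left_mono member_le_sum) auto
      finally show "cmod (\<sigma> g i j) \<le> D * (\<Sum>j<n. norm (\<rho> g *v w j))" .
    qed (use nonneg D(1) in simp)
    also have "\<dots> \<le> (n * D + 1) * (\<Sum>j<n. norm (\<rho> g *v w j))"
      using nonneg by (simp add: algebra_simps)
    finally show ?thesis .
  qed
  show ?thesis
    by (rule that[OF irr _ _ bound]) (use wB B(1) V(2) D(1) in \<open>auto intro: add_nonneg_pos\<close>)
qed

section \<open>Automorphy factors and matrix norms\<close>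

definition moebius_numerator :: "real^2^2 \<Rightarrow> complex \<Rightarrow> complex" where
  "moebius_numerator A \<tau> = of_real (A $ 1 $ 1) * \<tau> + of_real (A $ 1 $ 2)"

lemma moebius_eq: "moebius A \<tau> = moebius_numerator A \<tau> / automorphy_factor A \<tau>"
  by (simp add: moebius_def moebius_numerator_def)

lemma automorphy_factor_mult:
  "automorphy_factor (A ** B) \<tau> =
     of_real (A $ 2 $ 1) * moebius_numerator B \<tau> + of_real (A $ 2 $ 2) * automorphy_factor B \<tau>"
  "moebius_numerator (A ** B) \<tau> =
     of_real (A $ 1 $ 1) * moebius_numerator B \<tau> + of_real (A $ 1 $ 2) * automorphy_factor B \<tau>"
  by (simp_all add: automorphy_factor_def moebius_numerator_def matrix_mult_2 algebra_simps)

lemma automorphy_factor_nonzero: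
  fixes A :: "real^2^2"
  assumes "det A = 1" "0 < Im \<tau>"
  shows "automorphy_factor A \<tau> \<noteq> 0"
proof
  assume "automorphy_factor A \<tau> = 0"
  then have "Im (automorphy_factor A \<tau>) = 0" "Re (automorphy_factor A \<tau>) = 0" by simp_all
  then have "A $ 2 $ 1 = 0" "A $ 2 $ 2 = 0"
    using assms(2) by (auto simp: automorphy_factor_def)
  then show False using assms(1) by (simp add: det_2)
qed

lemma Im_moebius:
  fixes A :: "real^2^2"
  assumes "det A = 1"
  shows "Im (moebius A \<tau>) = Im \<tau> / (cmod (automorphy_factor A \<tau>))\<^sup>2"
proof -
  have "Im (moebius_numerator A \<tau>) * Re (automorphy_factor A \<tau>) -
      Re (moebius_numerator A \<tau>) * Im (automorphy_factor A \<tau>) = det A * Im \<tau>"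
    by (simp add: moebius_numerator_def automorphy_factor_def det_2 algebra_simps)
  then show ?thesis
    using assms by (simp add: moebius_eq Im_divide cmod_power2)
qed

lemma moebius_in_upper_half_plane:
  fixes A :: "real^2^2"
  assumes "det A = 1" "\<tau> \<in> upper_half_plane"
  shows "moebius A \<tau> \<in> upper_half_plane"
  using assms automorphy_factor_nonzero[of A \<tau>] by (simp add: upper_half_plane_def Im_moebius)

text \<open>A real linear form in \<open>(\<tau>, 1)\<close> controls its coefficients because \<open>\<tau>\<close> is not real: the
  imaginary part gives \<open>a\<close>, and then the form gives \<open>b\<close>.\<close>
lemma norm_le_linear_form:
  fixes a b :: real
  assumes "0 < Im \<tau>"
  shows "\<bar>a\<bar> + \<bar>b\<bar> \<le> (1 + (1 + cmod \<tau>) / Im \<tau>) * cmod (of_real a * \<tau> + of_real b)"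
proof -
  let ?u = "of_real a * \<tau> + of_real b :: complex"
  have "\<bar>a\<bar> * Im \<tau> = \<bar>Im ?u\<bar>" using assms by (simp add: abs_mult)
  also have "\<dots> \<le> cmod ?u" by (rule abs_Im_le_cmod)
  finally have a: "\<bar>a\<bar> \<le> cmod ?u / Im \<tau>" using assms by (simp add: pos_le_divide_eq)
  have "\<bar>b\<bar> = cmod (?u - of_real a * \<tau>)" by simp
  also have "\<dots> \<le> cmod ?u + \<bar>a\<bar> * cmod \<tau>"
    by (rule order_trans[OF norm_triangle_ineq4]) (simp add: norm_mult)
  also have "\<dots> \<le> cmod ?u + cmod ?u / Im \<tau> * cmod \<tau>"
    using a by (intro add_left_mono mult_right_mono) auto
  finally have "\<bar>a\<bar> + \<bar>b\<bar> \<le> cmod ?u / Im \<tau> + (cmod ?u + cmod ?u / Im \<tau> * cmod \<tau>)"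
    using a by (intro add_mono)
  also have "\<dots> = (1 + (1 + cmod \<tau>) / Im \<tau>) * cmod ?u"
    by (simp add: algebra_simps add_divide_distrib)
  finally show ?thesis .
qed

lemma linear_form_le_norm:
  fixes A :: "real^2^2"
  shows "cmod (moebius_numerator A \<tau>) \<le> (1 + cmod \<tau>) * norm A"
    "cmod (automorphy_factor A \<tau>) \<le> (1 + cmod \<tau>) * norm A"
proof -
  have entry: "\<bar>A $ i $ j\<bar> \<le> norm A" for i j
    by (metis Finite_Cartesian_Product.norm_nth_le order_trans real_norm_def)
  have "cmod (of_real a * \<tau> + of_real b) \<le> (1 + cmod \<tau>) * norm A"
    if "\<bar>a\<bar> \<le> norm A" "\<bar>b\<bar> \<le> norm A" for a b
  proof -
    have "cmod (of_real a * \<tau> + of_real b) \<le> \<bar>a\<bar> * cmod \<tau> + \<bar>b\<bar>"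
      by (rule order_trans[OF norm_triangle_ineq]) (simp add: norm_mult)
    also have "\<dots> \<le> norm A * cmod \<tau> + norm A"
      using that by (intro add_mono mult_right_mono) auto
    finally show ?thesis by (simp add: algebra_simps)
  qed
  then show "cmod (moebius_numerator A \<tau>) \<le> (1 + cmod \<tau>) * norm A"
    "cmod (automorphy_factor A \<tau>) \<le> (1 + cmod \<tau>) * norm A"
    unfolding moebius_numerator_def automorphy_factor_def using entry by auto
qed

text \<open>The automorphy factor of \<open>A\<close> controls only the second row of \<open>A\<close>. That of \<open>A0 ** A\<close>
  involves the first row as well, with the nonzero coefficient \<open>A0 $ 2 $ 1\<close>. So at least one of
  the two factors is as large as \<open>A\<close>.\<close>
lemma norm_le_automorphy_factors:
  fixes A0 :: "real^2^2"
  assumes "A0 $ 2 $ 1 \<noteq> 0" "0 < Im \<tau>"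
  obtains K where "0 < K"
    "\<And>A. norm A \<le> K * max (cmod (automorphy_factor A \<tau>)) (cmod (automorphy_factor (A0 ** A) \<tau>))"
proof -
  define \<kappa> where "\<kappa> = 1 + (1 + cmod \<tau>) / Im \<tau>"
  have \<kappa>: "\<kappa> > 0" unfolding \<kappa>_def using assms(2) by (intro add_pos_nonneg) auto
  define c d where "c = \<bar>A0 $ 2 $ 1\<bar>" and "d = \<bar>A0 $ 2 $ 2\<bar>"
  have c: "c > 0" "d \<ge> 0" using assms(1) by (simp_all add: c_def d_def)
  show ?thesis
  proof (rule that)
    show "0 < \<kappa> * ((1 + d) / c + 1)" using \<kappa> c by (intro mult_pos_pos add_nonneg_pos) auto
    fix A
    let ?u = "cmod (moebius_numerator A \<tau>)" and ?j = "cmod (automorphy_factor A \<tau>)"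
    let ?j' = "cmod (automorphy_factor (A0 ** A) \<tau>)"
    have "of_real (A0 $ 2 $ 1) * moebius_numerator A \<tau> =
        automorphy_factor (A0 ** A) \<tau> - of_real (A0 $ 2 $ 2) * automorphy_factor A \<tau>"
      by (simp add: automorphy_factor_mult)
    then have "c * ?u = cmod (automorphy_factor (A0 ** A) \<tau> - of_real (A0 $ 2 $ 2) * automorphy_factor A \<tau>)"
      by (metis c_def norm_mult norm_of_real)
    also have "\<dots> \<le> ?j' + d * ?j"
      by (rule order_trans[OF norm_triangle_ineq4]) (simp add: norm_mult d_def)
    also have "\<dots> \<le> max ?j ?j' + d * max ?j ?j'"
      using c by (intro add_mono mult_left_mono) auto
    finally have u: "?u \<le> (1 + d) / c * max ?j ?j'" using c by (simp add: field_simps)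
    have "norm A \<le> (\<Sum>i\<in>UNIV. \<Sum>j\<in>UNIV. norm (A $ i $ j))" by (rule norm_le_sum_cmod_entries)
    also have "\<dots> = (\<bar>A $ 1 $ 1\<bar> + \<bar>A $ 1 $ 2\<bar>) + (\<bar>A $ 2 $ 1\<bar> + \<bar>A $ 2 $ 2\<bar>)"
      by (simp add: sum_2)
    also have "\<dots> \<le> \<kappa> * ?u + \<kappa> * ?j"
      unfolding moebius_numerator_def automorphy_factor_def \<kappa>_def
      by (intro add_mono norm_le_linear_form assms(2))
    also have "\<dots> \<le> \<kappa> * ((1 + d) / c * max ?j ?j') + \<kappa> * max ?j ?j'"
      using u \<kappa> by (intro add_mono mult_left_mono) auto
    also have "\<dots> = \<kappa> * ((1 + d) / c + 1) * max ?j ?j'" by (simp add: algebra_simps)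
    finally show "norm A \<le> \<kappa> * ((1 + d) / c + 1) * max ?j ?j'" .
  qed
qed

lemma norm_matrix_matrix_mult_le:
  fixes A0 :: "real^2^2"
  obtains K where "0 < K" "\<And>A :: real^2^2. norm (A0 ** A) \<le> K * norm A"
proof -
  have "linear (\<lambda>A :: real^2^2. A0 ** A)"
    by (rule linearI) (simp_all add: vec_eq_iff matrix_mult_2 algebra_simps)
  then show ?thesis using linear_bounded_pos that by blast
qed

section \<open>Growth of functions on the upper half plane\<close>

lemma powr_comparable_le:
  fixes x L K s :: real
  assumes "0 < L" "L / K \<le> x" "x \<le> K * L" "1 \<le> K"
  shows "x powr s \<le> K powr \<bar>s\<bar> * L powr s"
proof -
  define q where "q = x / L"
  have x: "x = q * L" using assms by (simp add: q_def)
  have q: "1 / K \<le> q" "q \<le> K" using assms by (simp_all add: q_def field_simps)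
  have "0 < 1 / K" using assms(4) by simp
  then have "0 < q" using q by linarith
  have "\<bar>ln q\<bar> \<le> ln K"
  proof -
    have "ln q \<le> ln K" using q \<open>0 < q\<close> assms by simp
    moreover have "ln (1 / K) \<le> ln q" using q \<open>0 < q\<close> \<open>0 < 1 / K\<close> by (subst ln_le_cancel_iff)
    ultimately show ?thesis using assms(4) by (simp add: ln_div abs_le_iff)
  qed
  then have "\<bar>s\<bar> * \<bar>ln q\<bar> \<le> \<bar>s\<bar> * ln K" by (intro mult_left_mono) auto
  then have "s * ln q \<le> \<bar>s\<bar> * ln K" by (metis abs_ge_self abs_mult order_trans)
  then have "q powr s \<le> K powr \<bar>s\<bar>" using \<open>0 < q\<close> assms(4) by (simp add: powr_def)
  then show ?thesis
    unfolding x using \<open>0 < q\<close> assms(1) by (simp add: powr_mult mult_right_mono)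
qed

text \<open>Both growth hypotheses of the theorem are instances: \<open>M = 0\<close>, and \<open>M = m - 1\<close> with the
  maximum over \<open>j \<le> M\<close> replaced by the larger \<open>max 1 (cmod \<tau>) ^ M\<close>.\<close>
definition polynomial_growth :: "nat \<Rightarrow> real \<Rightarrow> (complex \<Rightarrow> complex^'m) \<Rightarrow> bool" where
  "polynomial_growth M \<zeta> X \<longleftrightarrow>
     (\<exists>C\<ge>0. \<forall>\<tau>\<in>upper_half_plane. norm (X \<tau>) \<le> C * (max 1 (cmod \<tau>) ^ M * Im \<tau> powr (-\<zeta>)))"

lemma growth_const_nonneg:
  assumes "\<forall>\<tau>\<in>upper_half_plane. norm (X \<tau>) \<le> C * g \<tau>" "g \<i> > (0::real)"
  shows "0 \<le> (C :: real)"
proof -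
  have "norm (X \<i>) \<le> C * g \<i>" using assms(1) by (simp add: upper_half_plane_def)
  then have "0 \<le> C * g \<i>" using norm_ge_zero order_trans by blast
  then show ?thesis using assms(2) by (simp add: zero_le_mult_iff)
qed

lemma polynomial_growthI:
  assumes "\<forall>\<tau>\<in>upper_half_plane. norm (X \<tau>) \<le> C * Im \<tau> powr (-\<zeta>)"
  shows "polynomial_growth 0 \<zeta> X"
  using assms growth_const_nonneg[OF assms] by (auto simp: polynomial_growth_def)

lemma polynomial_growth_MaxI:
  assumes "\<forall>\<tau>\<in>upper_half_plane. norm (X \<tau>) \<le> C * (MAX j\<in>{0..M}. cmod \<tau> ^ j * Im \<tau> powr (-\<zeta>))"
  shows "polynomial_growth M \<zeta> X"
  unfolding polynomial_growth_def
proof (intro exI conjI ballI)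
  show C: "0 \<le> C"
    by (rule growth_const_nonneg[OF assms]) (simp add: image_constant_conv)
  fix \<tau> assume \<tau>: "\<tau> \<in> upper_half_plane"
  have "(MAX j\<in>{0..M}. cmod \<tau> ^ j * Im \<tau> powr (-\<zeta>)) \<le> max 1 (cmod \<tau>) ^ M * Im \<tau> powr (-\<zeta>)"
  proof (rule Max.boundedI)
    fix x assume "x \<in> (\<lambda>j. cmod \<tau> ^ j * Im \<tau> powr (-\<zeta>)) ` {0..M}"
    then obtain j where j: "j \<le> M" "x = cmod \<tau> ^ j * Im \<tau> powr (-\<zeta>)" by auto
    have "cmod \<tau> ^ j \<le> max 1 (cmod \<tau>) ^ j" by (intro power_mono) auto
    also have "\<dots> \<le> max 1 (cmod \<tau>) ^ M" using j(1) by (intro power_increasing) auto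
    finally show "x \<le> max 1 (cmod \<tau>) ^ M * Im \<tau> powr (-\<zeta>)"
      unfolding j(2) by (intro mult_right_mono) auto
  qed auto
  then show "norm (X \<tau>) \<le> C * (max 1 (cmod \<tau>) ^ M * Im \<tau> powr (-\<zeta>))"
    using assms \<tau> C by (meson mult_left_mono order_trans)
qed

text \<open>The growth bound is continuous in the upper half plane, so it bounds the function near every point.\<close>
lemma polynomial_growth_no_poles:
  assumes "polynomial_growth M \<zeta> X" "\<tau> \<in> upper_half_plane"
  shows "\<not> vector_pole X \<tau>"
proof
  assume "vector_pole X \<tau>"
  then obtain i where pole: "filterlim (\<lambda>t. X t $ i) at_infinity (at \<tau>)"
    by (auto simp: vector_pole_def is_pole_def)
  obtain C where C: "\<forall>\<tau>\<in>upper_half_plane. norm (X \<tau>) \<le> C * (max 1 (cmod \<tau>) ^ M * Im \<tau> powr (-\<zeta>))"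
    using assms(1) by (auto simp: polynomial_growth_def)
  let ?g = "\<lambda>t. C * (max 1 (cmod t) ^ M * Im t powr (-\<zeta>))"
  have "Im \<tau> \<noteq> 0" using assms(2) by (simp add: upper_half_plane_def)
  then have "(?g \<longlongrightarrow> ?g \<tau>) (at \<tau>)" by (intro tendsto_intros) auto
  moreover have "filterlim ?g at_top (at \<tau>)"
  proof (rule filterlim_at_top_mono)
    show "filterlim (\<lambda>t. norm (X t $ i)) at_top (at \<tau>)"
      using pole by (rule filterlim_at_infinity_imp_norm_at_top)
    have "eventually (\<lambda>t. t \<in> upper_half_plane) (at \<tau>)"
      using assms(2) unfolding upper_half_plane_def
      by (intro eventually_at_in_open' open_halfspace_Im_gt)
    then show "eventually (\<lambda>t. norm (X t $ i) \<le> ?g t) (at \<tau>)"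
      by eventually_elim (use C Finite_Cartesian_Product.norm_nth_le order_trans in blast)
  qed
  then have "filterlim ?g at_infinity (at \<tau>)"
    by (rule filterlim_mono) (auto simp: at_top_le_at_infinity)
  ultimately show False using not_tendsto_and_filterlim_at_infinity[of "at \<tau>"] by simp
qed

text \<open>The core estimate. Suppose that the automorphy factor \<open>j\<close> is comparable to \<open>L\<close> and that
  the numerator is at most of this size. Then \<open>moebius A \<tau>\<close> stays in a bounded region, so that
  powers of its absolute value are harmless, and its imaginary part is comparable to \<open>1 / L\<^sup>2\<close>.
  The growth of \<open>X\<close> contributes \<open>L powr (2 * \<zeta>)\<close> and the weight contributes \<open>L powr (- k)\<close>.\<close>
lemma transported_vector_bound:
  fixes v :: "complex^'m" and A :: "real^2^2"
  assumes X: "norm (X (moebius A \<tau>)) \<le>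
      C * (max 1 (cmod (moebius A \<tau>)) ^ M * Im (moebius A \<tau>) powr (-\<zeta>))" and "0 \<le> C"
    and trans: "X (moebius A \<tau>) = automorphy_factor A \<tau> powi k *s v"
    and A: "det A = 1" and \<tau>: "0 < Im \<tau>" and K: "1 \<le> K" and L: "0 < L"
    and bounds: "L / K \<le> cmod (automorphy_factor A \<tau>)" "cmod (automorphy_factor A \<tau>) \<le> K * L"
      "cmod (moebius_numerator A \<tau>) \<le> K * L"
  shows "norm v \<le> C * (K\<^sup>2 ^ M * Im \<tau> powr (-\<zeta>)) * K powr \<bar>2 * \<zeta> - of_int k\<bar> *
    L powr (2 * \<zeta> - of_int k)"
proof -
  let ?j = "cmod (automorphy_factor A \<tau>)"
  have j: "?j > 0" using automorphy_factor_nonzero[OF A \<tau>] by simp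
  have "cmod (moebius A \<tau>) \<le> K * L / (L / K)"
    unfolding moebius_eq norm_divide using bounds j K L by (intro frac_le) auto
  also have "\<dots> = K\<^sup>2" using L by (simp add: power2_eq_square)
  finally have "max 1 (cmod (moebius A \<tau>)) \<le> K\<^sup>2" using K by simp
  then have "max 1 (cmod (moebius A \<tau>)) ^ M \<le> K\<^sup>2 ^ M" by (intro power_mono) auto
  moreover have "Im (moebius A \<tau>) powr (-\<zeta>) = Im \<tau> powr (-\<zeta>) * ?j powr (2 * \<zeta>)"
  proof -
    have "?j\<^sup>2 = ?j powr 2" using j by simp
    then have "(Im \<tau> / ?j\<^sup>2) powr (-\<zeta>) = Im \<tau> powr (-\<zeta>) / ?j powr (2 * (-\<zeta>))"
      using \<tau> j by (simp only: powr_divide powr_powr less_imp_le)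
    then show ?thesis using A by (simp add: Im_moebius powr_minus divide_inverse)
  qed
  ultimately have "norm (X (moebius A \<tau>)) \<le> C * (K\<^sup>2 ^ M * (Im \<tau> powr (-\<zeta>) * ?j powr (2 * \<zeta>)))"
    using X \<open>0 \<le> C\<close> by (auto intro!: order_trans[OF X] mult_left_mono mult_right_mono)
  moreover have "norm (X (moebius A \<tau>)) = ?j powr (of_int k) * norm v"
    unfolding trans norm_vector_scalar_mult norm_power_int
    using j by (simp add: powr_real_of_int')
  ultimately have "?j powr (of_int k) * norm v \<le> C * (K\<^sup>2 ^ M * Im \<tau> powr (-\<zeta>)) * ?j powr (2 * \<zeta>)"
    by (simp add: mult_ac)
  then have "norm v \<le> C * (K\<^sup>2 ^ M * Im \<tau> powr (-\<zeta>)) * (?j powr (2 * \<zeta>) / ?j powr (of_int k))"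
    using j by (simp add: field_simps)
  also have "\<dots> = C * (K\<^sup>2 ^ M * Im \<tau> powr (-\<zeta>)) * ?j powr (2 * \<zeta> - of_int k)"
    by (simp add: powr_diff)
  also have "\<dots> \<le> C * (K\<^sup>2 ^ M * Im \<tau> powr (-\<zeta>)) *
      (K powr \<bar>2 * \<zeta> - of_int k\<bar> * L powr (2 * \<zeta> - of_int k))"
    using \<open>0 \<le> C\<close> K by (intro mult_left_mono powr_comparable_le L bounds mult_nonneg_nonneg) auto
  finally show ?thesis by (simp add: mult_ac)
qed

section \<open>Growth of representations\<close>

text \<open>Either \<open>\<gamma>\<close> or \<open>g0 \<otimes> \<gamma>\<close>, for one fixed \<open>g0\<close> that moves infinity, has an
  automorphy factor comparable to \<open>norm A\<close>. In the second case the bound for \<open>g0 \<otimes> \<gamma>\<close>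
  carries over to \<open>\<gamma>\<close> because \<open>\<rho> g0\<close> is a fixed invertible matrix.\<close>
lemma representation_growth_on_values:
  fixes X :: "complex \<Rightarrow> complex^'m" and G :: "(real^2^2) set set"
  assumes G: "Fuchsian_group_first_kind G"
    and \<rho>: "GL_representation (PSL2R\<lparr>carrier := G\<rparr>) \<rho>"
    and trans: "transforms_with_weight G k \<rho> X"
    and growth: "polynomial_growth M \<zeta> X"
    and \<tau>: "\<tau> \<in> upper_half_plane"
  shows "\<exists>D. \<forall>\<gamma>\<in>G. \<forall>A\<in>\<gamma>. norm (\<rho> \<gamma> *v X \<tau>) \<le> D * norm A powr (2 * \<zeta> - of_int k)"
proof -
  have sub: "subgroup G PSL2R"
    using G by (simp add: Fuchsian_group_first_kind_def Fuchsian_group_def)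
  have det: "det A = 1" if "\<gamma> \<in> G" "A \<in> \<gamma>" for \<gamma> A
    using PSL2R_class(1) subgroup.subset[OF sub] that by blast
  have Im: "0 < Im \<tau>" using \<tau> by (simp add: upper_half_plane_def)
  obtain C where C: "C \<ge> 0"
    "\<forall>\<tau>\<in>upper_half_plane. norm (X \<tau>) \<le> C * (max 1 (cmod \<tau>) ^ M * Im \<tau> powr (-\<zeta>))"
    using growth unfolding polynomial_growth_def by blast
  have in_H: "moebius A \<tau> \<in> upper_half_plane" if "\<gamma> \<in> G" "A \<in> \<gamma>" for \<gamma> A
    by (rule moebius_in_upper_half_plane[OF det[OF that] \<tau>])
  have X_trans: "X (moebius A \<tau>) = automorphy_factor A \<tau> powi k *s (\<rho> \<gamma> *v X \<tau>)"
    if "\<gamma> \<in> G" "A \<in> \<gamma>" for \<gamma> A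
    using trans that \<tau> in_H[OF that] polynomial_growth_no_poles[OF growth]
    unfolding transforms_with_weight_def by blast
  obtain g0 A0 where g0: "g0 \<in> G" "A0 \<in> g0" "A0 $ 2 $ 1 \<noteq> 0"
    using first_kind_moves_infinity[OF G] by blast
  obtain K1 where K1: "0 < K1"
    "\<And>A. norm A \<le> K1 * max (cmod (automorphy_factor A \<tau>)) (cmod (automorphy_factor (A0 ** A) \<tau>))"
    using norm_le_automorphy_factors[OF g0(3) Im] by blast
  obtain K2 where K2: "0 < K2" "\<And>A :: real^2^2. norm (A0 ** A) \<le> K2 * norm A"
    using norm_matrix_matrix_mult_le by blast
  \<comment> \<open>large enough for the lower bound on one of the two automorphy factors and for the upper bounds
    on the numerators and automorphy factors of both \<open>A\<close> and \<open>A0 ** A\<close>\<close>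
  define K where "K = K1 + (1 + cmod \<tau>) * (1 + K2)"
  have "1 * 1 \<le> (1 + cmod \<tau>) * (1 + K2)" using K2 by (intro mult_mono) auto
  then have K: "1 \<le> K" "K1 \<le> K" using K1(1) unfolding K_def by linarith+
  define D where "D = C * (K\<^sup>2 ^ M * Im \<tau> powr (-\<zeta>)) * K powr \<bar>2 * \<zeta> - of_int k\<bar>"
  have D: "D \<ge> 0" unfolding D_def using C(1) by simp
  \<comment> \<open>\<open>L\<close> is the norm of the given matrix, also when the bound is applied to \<open>A0 ** A\<close>\<close>
  have good: "norm (\<rho> \<gamma> *v X \<tau>) \<le> D * L powr (2 * \<zeta> - of_int k)"
    if A: "\<gamma> \<in> G" "A \<in> \<gamma>" and L: "0 < L" "norm A \<le> (1 + K2) * L"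
      "L \<le> K * cmod (automorphy_factor A \<tau>)" for \<gamma> A L
    unfolding D_def
  proof (rule transported_vector_bound[where X = X and \<tau> = \<tau>])
    show "L / K \<le> cmod (automorphy_factor A \<tau>)" using L K by (simp add: field_simps)
    have "(1 + cmod \<tau>) * norm A \<le> (1 + cmod \<tau>) * ((1 + K2) * L)"
      using L by (intro mult_left_mono) auto
    also have "\<dots> = (1 + cmod \<tau>) * (1 + K2) * L" by (rule mult.assoc[symmetric])
    also have "\<dots> \<le> K * L" unfolding K_def using K1 L by (intro mult_right_mono) auto
    finally show "cmod (automorphy_factor A \<tau>) \<le> K * L" "cmod (moebius_numerator A \<tau>) \<le> K * L"
      using linear_form_le_norm order_trans by blast+
  qed (use C in_H[OF A] X_trans[OF A] det[OF A] Im K(1) L(1) in auto)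
  have hom: "\<rho> (g0 \<otimes>\<^bsub>PSL2R\<^esub> \<gamma>) = \<rho> g0 ** \<rho> \<gamma>" if "\<gamma> \<in> G" for \<gamma>
    using \<rho> that g0(1) by (auto simp: GL_representation_def hom_def GL_def)
  have "invertible (\<rho> g0)"
    using \<rho> g0(1) by (auto simp: GL_representation_def hom_def GL_def)
  then obtain R where R: "R ** \<rho> g0 = mat 1" unfolding invertible_def by blast
  obtain K3 where K3: "0 < K3" "\<And>v. norm (R *v v) \<le> K3 * norm v"
    using matrix_vector_mult_bounded by blast
  show ?thesis
  proof (intro exI ballI)
    fix \<gamma> A assume A: "\<gamma> \<in> G" "A \<in> \<gamma>"
    have "A \<noteq> 0" using det[OF A] by (auto simp: det_2)
    then have pos: "0 < norm A" by simp
    let ?j = "cmod (automorphy_factor A \<tau>)" and ?j' = "cmod (automorphy_factor (A0 ** A) \<tau>)"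
    let ?B = "D * norm A powr (2 * \<zeta> - of_int k)"
    have B: "0 \<le> ?B" using D by simp
    have "norm A \<le> K1 * ?j \<or> norm A \<le> K1 * ?j'" using K1(2)[of A] by (auto simp: max_def split: if_splits)
    then have "norm (\<rho> \<gamma> *v X \<tau>) \<le> ?B \<or> norm (\<rho> \<gamma> *v X \<tau>) \<le> K3 * ?B"
    proof
      assume "norm A \<le> K1 * ?j"
      also have "\<dots> \<le> K * ?j" using K by (intro mult_right_mono) auto
      finally have "norm (\<rho> \<gamma> *v X \<tau>) \<le> ?B"
        using pos K2(1) by (intro good[OF A]) auto
      then show ?thesis ..
    next
      assume "norm A \<le> K1 * ?j'"
      also have "\<dots> \<le> K * ?j'" using K by (intro mult_right_mono) auto
      finally have "norm A \<le> K * ?j'" .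
      moreover have "norm (A0 ** A) \<le> (1 + K2) * norm A"
        using K2(2)[of A] by (simp add: algebra_simps add_increasing)
      ultimately have "norm (\<rho> (g0 \<otimes>\<^bsub>PSL2R\<^esub> \<gamma>) *v X \<tau>) \<le> ?B"
        using pos subgroup.m_closed[OF sub g0(1) A(1)] PSL2R_mult[OF g0(2) A(2)]
        by (intro good) auto
      then have "K3 * norm (\<rho> (g0 \<otimes>\<^bsub>PSL2R\<^esub> \<gamma>) *v X \<tau>) \<le> K3 * ?B"
        using K3(1) by (intro mult_left_mono) auto
      moreover have "\<rho> \<gamma> *v X \<tau> = R *v (\<rho> (g0 \<otimes>\<^bsub>PSL2R\<^esub> \<gamma>) *v X \<tau>)"
        by (simp add: hom[OF A(1)] matrix_vector_mul_assoc matrix_mul_assoc R)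
      ultimately have "norm (\<rho> \<gamma> *v X \<tau>) \<le> K3 * ?B" using K3(2) by (metis order_trans)
      then show ?thesis ..
    qed
    moreover have "0 \<le> K3 * ?B" using D K3(1) by simp
    ultimately have "norm (\<rho> \<gamma> *v X \<tau>) \<le> ?B + K3 * ?B" using B by linarith
    then show "norm (\<rho> \<gamma> *v X \<tau>) \<le> (D + K3 * D) * norm A powr (2 * \<zeta> - of_int k)"
      by (simp add: algebra_simps)
  qed
qed

lemma subspace_of_bounded_vectors:
  fixes \<rho> :: "(real^2^2) set \<Rightarrow> complex^'m^'m"
  shows "vec.subspace {v. \<exists>D. \<forall>\<gamma>\<in>G. \<forall>A\<in>\<gamma>. norm (\<rho> \<gamma> *v v) \<le> D * norm A powr s}"
proof (rule vec.subspaceI)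
  show "0 \<in> {v. \<exists>D. \<forall>\<gamma>\<in>G. \<forall>A\<in>\<gamma>. norm (\<rho> \<gamma> *v v) \<le> D * norm A powr s}"
    by (auto intro: exI[of _ 0])
next
  fix v w
  assume "v \<in> {v. \<exists>D. \<forall>\<gamma>\<in>G. \<forall>A\<in>\<gamma>. norm (\<rho> \<gamma> *v v) \<le> D * norm A powr s}"
    and "w \<in> {v. \<exists>D. \<forall>\<gamma>\<in>G. \<forall>A\<in>\<gamma>. norm (\<rho> \<gamma> *v v) \<le> D * norm A powr s}"
  then obtain D E where
    D: "\<forall>\<gamma>\<in>G. \<forall>A\<in>\<gamma>. norm (\<rho> \<gamma> *v v) \<le> D * norm A powr s" and
    E: "\<forall>\<gamma>\<in>G. \<forall>A\<in>\<gamma>. norm (\<rho> \<gamma> *v w) \<le> E * norm A powr s" by auto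
  have "norm (\<rho> \<gamma> *v (v + w)) \<le> (D + E) * norm A powr s" if "\<gamma> \<in> G" "A \<in> \<gamma>" for \<gamma> A
    unfolding vec.add distrib_right using D E that by (intro norm_triangle_mono) auto
  then show "v + w \<in> {v. \<exists>D. \<forall>\<gamma>\<in>G. \<forall>A\<in>\<gamma>. norm (\<rho> \<gamma> *v v) \<le> D * norm A powr s}" by blast
next
  fix c v
  assume "v \<in> {v. \<exists>D. \<forall>\<gamma>\<in>G. \<forall>A\<in>\<gamma>. norm (\<rho> \<gamma> *v v) \<le> D * norm A powr s}"
  then obtain D where D: "\<forall>\<gamma>\<in>G. \<forall>A\<in>\<gamma>. norm (\<rho> \<gamma> *v v) \<le> D * norm A powr s" by auto
  have "norm (\<rho> \<gamma> *v (c *s v)) \<le> (cmod c * D) * norm A powr s" if "\<gamma> \<in> G" "A \<in> \<gamma>" for \<gamma> A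
    unfolding vec.scale norm_vector_scalar_mult mult.assoc using D that by (intro mult_left_mono) auto
  then show "c *s v \<in> {v. \<exists>D. \<forall>\<gamma>\<in>G. \<forall>A\<in>\<gamma>. norm (\<rho> \<gamma> *v v) \<le> D * norm A powr s}" by blast
qed

text \<open>By the transformation law, \<open>\<rho> \<gamma>\<close> maps a value of \<open>X\<close> to a multiple of another value.\<close>
lemma invariant_subspace_span_values:
  fixes X :: "complex \<Rightarrow> complex^'m" and G :: "(real^2^2) set set"
  assumes sub: "subgroup G PSL2R"
    and trans: "transforms_with_weight G k \<rho> X"
    and no_poles: "\<And>\<tau>. \<tau> \<in> upper_half_plane \<Longrightarrow> \<not> vector_pole X \<tau>"
  shows "invariant_subspace (PSL2R\<lparr>carrier := G\<rparr>) \<rho> (vec.span (X ` upper_half_plane))"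
  unfolding invariant_subspace_def
proof (intro conjI ballI)
  let ?W = "vec.span (X ` upper_half_plane)"
  fix \<gamma> u assume "\<gamma> \<in> carrier (PSL2R\<lparr>carrier := G\<rparr>)" and u: "u \<in> ?W"
  then have \<gamma>: "\<gamma> \<in> G" "\<gamma> \<in> carrier PSL2R" using subgroup.subset[OF sub] by auto
  then obtain A where A: "A \<in> \<gamma>" by (auto simp: carrier_PSL2R)
  have det: "det A = 1" using PSL2R_class(1)[OF \<gamma>(2) A] .
  have "?W \<subseteq> {v. \<rho> \<gamma> *v v \<in> ?W}"
  proof (rule vec.span_minimal)
    show "X ` upper_half_plane \<subseteq> {v. \<rho> \<gamma> *v v \<in> ?W}"
    proof clarify
      fix \<tau> assume \<tau>: "\<tau> \<in> upper_half_plane"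
      then have j: "automorphy_factor A \<tau> \<noteq> 0"
        by (intro automorphy_factor_nonzero det) (simp add: upper_half_plane_def)
      have H: "moebius A \<tau> \<in> upper_half_plane"
        by (rule moebius_in_upper_half_plane[OF det \<tau>])
      have "X (moebius A \<tau>) = automorphy_factor A \<tau> powi k *s (\<rho> \<gamma> *v X \<tau>)"
        using trans \<gamma>(1) A \<tau> H no_poles unfolding transforms_with_weight_def by blast
      then have "\<rho> \<gamma> *v X \<tau> = inverse (automorphy_factor A \<tau> powi k) *s X (moebius A \<tau>)"
        using j by simp
      then show "\<rho> \<gamma> *v X \<tau> \<in> ?W"
        by (metis H imageI vec.span_base vec.span_scale)
    qed
    show "vec.subspace {v. \<rho> \<gamma> *v v \<in> ?W}"
      by (rule vec.subspaceI)
        (simp_all add: vec.add vec.scale vec.span_zero vec.span_add vec.span_scale)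
  qed
  then show "\<rho> \<gamma> *v u \<in> ?W" using u by auto
qed (rule vec.subspace_span)

lemma representation_growth_on_span:
  fixes X :: "complex \<Rightarrow> complex^'m" and G :: "(real^2^2) set set"
  assumes "Fuchsian_group_first_kind G" "GL_representation (PSL2R\<lparr>carrier := G\<rparr>) \<rho>"
    "transforms_with_weight G k \<rho> X" "polynomial_growth M \<zeta> X"
    and v: "v \<in> vec.span (X ` upper_half_plane)"
  shows "\<exists>D. \<forall>\<gamma>\<in>G. \<forall>A\<in>\<gamma>. norm (\<rho> \<gamma> *v v) \<le> D * norm A powr (2 * \<zeta> - of_int k)"
proof -
  have "vec.span (X ` upper_half_plane) \<subseteq>
      {v. \<exists>D. \<forall>\<gamma>\<in>G. \<forall>A\<in>\<gamma>. norm (\<rho> \<gamma> *v v) \<le> D * norm A powr (2 * \<zeta> - of_int k)}"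
    by (rule vec.span_minimal[OF _ subspace_of_bounded_vectors])
      (use representation_growth_on_values[OF assms(1-4)] in blast)
  then show ?thesis using v by blast
qed

lemma irreducible_growth:
  fixes X :: "complex \<Rightarrow> complex^'m" and G :: "(real^2^2) set set"
  assumes G: "Fuchsian_group_first_kind G" "GL_representation (PSL2R\<lparr>carrier := G\<rparr>) \<rho>"
    "transforms_with_weight G k \<rho> X" "polynomial_growth M \<zeta> X"
    and nz: "\<exists>\<tau>\<in>upper_half_plane. X \<tau> \<noteq> 0"
    and irr: "irreducible_representation (PSL2R\<lparr>carrier := G\<rparr>) \<rho>"
  shows "\<exists>C\<ge>0. \<forall>\<gamma>\<in>G. \<forall>A\<in>\<gamma>. norm (\<rho> \<gamma>) \<le> C * norm A powr (2 * \<zeta> - of_int k)"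
proof -
  let ?W = "vec.span (X ` upper_half_plane)"
  have "subgroup G PSL2R"
    using G(1) by (simp add: Fuchsian_group_first_kind_def Fuchsian_group_def)
  then have "invariant_subspace (PSL2R\<lparr>carrier := G\<rparr>) \<rho> ?W"
    using G(3) polynomial_growth_no_poles[OF G(4)] by (rule invariant_subspace_span_values)
  moreover obtain \<tau> where "\<tau> \<in> upper_half_plane" "X \<tau> \<noteq> 0" using nz by blast
  then have "?W \<noteq> {0}" using vec.span_base[of "X \<tau>" "X ` upper_half_plane"] by auto
  ultimately have W: "?W = UNIV" using irr unfolding irreducible_representation_def by blast
  have "\<exists>D. \<forall>\<gamma>\<in>G. \<forall>A\<in>\<gamma>. norm (\<rho> \<gamma> *v axis j 1) \<le> D * norm A powr (2 * \<zeta> - of_int k)" for j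
    by (rule representation_growth_on_span[OF G]) (simp add: W)
  then obtain D where
    D: "\<And>j \<gamma> A. \<gamma> \<in> G \<Longrightarrow> A \<in> \<gamma> \<Longrightarrow> norm (\<rho> \<gamma> *v axis j 1) \<le> D j * norm A powr (2 * \<zeta> - of_int k)"
    by metis
  show ?thesis
  proof (intro exI conjI ballI)
    show "0 \<le> CARD('m) * (\<Sum>j\<in>UNIV. \<bar>D j\<bar>)" by (intro mult_nonneg_nonneg sum_nonneg) auto
    fix \<gamma> A assume A: "\<gamma> \<in> G" "A \<in> \<gamma>"
    have "norm (\<rho> \<gamma>) \<le> CARD('m) * (\<Sum>j\<in>UNIV. norm (\<rho> \<gamma> *v axis j 1))"
      by (rule norm_matrix_le_sum_columns)
    also have "\<dots> \<le> CARD('m) * (\<Sum>j\<in>UNIV. \<bar>D j\<bar> * norm A powr (2 * \<zeta> - of_int k))"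
      by (intro mult_left_mono sum_mono order_trans[OF D[OF A]] mult_right_mono) auto
    finally show "norm (\<rho> \<gamma>) \<le> CARD('m) * (\<Sum>j\<in>UNIV. \<bar>D j\<bar>) * norm A powr (2 * \<zeta> - of_int k)"
      by (simp add: sum_distrib_right mult.assoc)
  qed
qed

lemma constituent_growth:
  fixes X :: "complex \<Rightarrow> complex^'m" and G :: "(real^2^2) set set"
  assumes G: "Fuchsian_group_first_kind G" "GL_representation (PSL2R\<lparr>carrier := G\<rparr>) \<rho>"
    "transforms_with_weight G k \<rho> X" "polynomial_growth M \<zeta> X"
    and nz: "\<exists>\<tau>\<in>upper_half_plane. X \<tau> \<noteq> 0"
  shows "\<exists>n \<sigma>. irreducible_constituent (PSL2R\<lparr>carrier := G\<rparr>) \<rho> n \<sigma> \<and>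
    (\<exists>C\<ge>0. \<forall>\<gamma>\<in>G. \<forall>A\<in>\<gamma>. entries_norm n (\<sigma> \<gamma>) \<le> C * norm A powr (2 * \<zeta> - of_int k))"
proof -
  let ?W = "vec.span (X ` upper_half_plane)"
  have "subgroup G PSL2R"
    using G(1) by (simp add: Fuchsian_group_first_kind_def Fuchsian_group_def)
  then have inv: "invariant_subspace (PSL2R\<lparr>carrier := G\<rparr>) \<rho> ?W"
    using G(3) polynomial_growth_no_poles[OF G(4)] by (rule invariant_subspace_span_values)
  obtain \<tau> where "\<tau> \<in> upper_half_plane" "X \<tau> \<noteq> 0" using nz by blast
  then have nz': "?W \<noteq> {0}" using vec.span_base[of "X \<tau>" "X ` upper_half_plane"] by auto
  obtain n \<sigma> w E where irr: "irreducible_constituent (PSL2R\<lparr>carrier := G\<rparr>) \<rho> n \<sigma>"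
    and w: "\<And>j. j < n \<Longrightarrow> w j \<in> ?W" and E: "0 < E"
      "\<And>g. g \<in> carrier (PSL2R\<lparr>carrier := G\<rparr>) \<Longrightarrow> entries_norm n (\<sigma> g) \<le> E * (\<Sum>j<n. norm (\<rho> g *v w j))"
    by (rule irreducible_constituent_of_subspace[OF inv nz']) blast
  have "\<exists>D. \<forall>\<gamma>\<in>G. \<forall>A\<in>\<gamma>. norm (\<rho> \<gamma> *v w j) \<le> D * norm A powr (2 * \<zeta> - of_int k)" if "j < n" for j
    by (rule representation_growth_on_span[OF G w[OF that]])
  then obtain D where D: "\<And>j \<gamma> A. j < n \<Longrightarrow> \<gamma> \<in> G \<Longrightarrow> A \<in> \<gamma> \<Longrightarrow>
      norm (\<rho> \<gamma> *v w j) \<le> D j * norm A powr (2 * \<zeta> - of_int k)"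
    by metis
  have "\<forall>\<gamma>\<in>G. \<forall>A\<in>\<gamma>. entries_norm n (\<sigma> \<gamma>) \<le> E * (\<Sum>j<n. \<bar>D j\<bar>) * norm A powr (2 * \<zeta> - of_int k)"
  proof (intro ballI)
    fix \<gamma> A assume A: "\<gamma> \<in> G" "A \<in> \<gamma>"
    have "entries_norm n (\<sigma> \<gamma>) \<le> E * (\<Sum>j<n. norm (\<rho> \<gamma> *v w j))" using E(2) A(1) by simp
    also have "\<dots> \<le> E * (\<Sum>j<n. \<bar>D j\<bar> * norm A powr (2 * \<zeta> - of_int k))"
      using E(1) by (intro mult_left_mono sum_mono order_trans[OF D[OF _ A]] mult_right_mono) auto
    finally show "entries_norm n (\<sigma> \<gamma>) \<le> E * (\<Sum>j<n. \<bar>D j\<bar>) * norm A powr (2 * \<zeta> - of_int k)"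
      by (simp add: sum_distrib_right mult.assoc)
  qed
  moreover have "0 \<le> E * (\<Sum>j<n. \<bar>D j\<bar>)" using E(1) by (intro mult_nonneg_nonneg sum_nonneg) auto
  ultimately show ?thesis using irr by blast
qed

text \<open>The bounds of the theorem that contain a maximum are implied by their term for \<open>j = 0\<close>.\<close>
lemma powr_le_Max_powr:
  fixes C s :: real
  assumes "0 \<le> C"
  shows "C * norm A powr s \<le> C * (MAX j\<in>{0..M}. norm A powr (real j + s))"
  by (intro mult_left_mono Max_ge assms) (auto intro!: image_eqI[of _ _ 0])

theorem theorem1p2:
  fixes G :: "(real^2^2) set set"
    and k :: int
    and X :: "complex \<Rightarrow> complex^'m"
    and \<rho> :: "(real^2^2) set \<Rightarrow> complex^'m^'m"
  assumes "Fuchsian_group_first_kind G"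
    and "even k"
    and "meromorphic_vector X upper_half_plane"
    and "\<exists>\<tau>\<in>upper_half_plane. X \<tau> \<noteq> 0"
    and "GL_representation (PSL2R\<lparr>carrier := G\<rparr>) \<rho>"
    and "transforms_with_weight G k \<rho> X"
  shows
    \<comment> \<open>(a)\<close>
    "(\<forall>\<zeta>>0.
        (\<exists>C. \<forall>\<tau>\<in>upper_half_plane. norm (X \<tau>) \<le> C * Im \<tau> powr (-\<zeta>)) \<longrightarrow>
        irreducible_representation (PSL2R\<lparr>carrier := G\<rparr>) \<rho> \<longrightarrow>
        (\<exists>C. \<forall>\<gamma>\<in>G. \<forall>A\<in>\<gamma>. norm (\<rho> \<gamma>) \<le> C * norm A powr (2 * \<zeta> - of_int k)))
    \<and> \<comment> \<open>(b)\<close>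
     (\<forall>\<zeta>>0.
        (\<exists>C. \<forall>\<tau>\<in>upper_half_plane.
           norm (X \<tau>) \<le> C * (MAX j\<in>{0..CARD('m) - 1}. cmod \<tau> ^ j * Im \<tau> powr (-\<zeta>))) \<longrightarrow>
        irreducible_representation (PSL2R\<lparr>carrier := G\<rparr>) \<rho> \<longrightarrow>
        (\<exists>C. \<forall>\<gamma>\<in>G. \<forall>A\<in>\<gamma>.
           norm (\<rho> \<gamma>) \<le> C * (MAX j\<in>{0..CARD('m) - 1}. norm A powr (real j + 2 * \<zeta> - of_int k))))
    \<and> \<comment> \<open>(c), under the growth hypothesis of (a)\<close>
     (\<forall>\<zeta>>0.
        (\<exists>C. \<forall>\<tau>\<in>upper_half_plane. norm (X \<tau>) \<le> C * Im \<tau> powr (-\<zeta>)) \<longrightarrow>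
        (\<exists>n \<sigma>. irreducible_constituent (PSL2R\<lparr>carrier := G\<rparr>) \<rho> n \<sigma> \<and>
           (\<exists>C. \<forall>\<gamma>\<in>G. \<forall>A\<in>\<gamma>.
              entries_norm n (\<sigma> \<gamma>) \<le> C * norm A powr (2 * \<zeta> - of_int k))))
    \<and> \<comment> \<open>(c), under the growth hypothesis of (b)\<close>
     (\<forall>\<zeta>>0.
        (\<exists>C. \<forall>\<tau>\<in>upper_half_plane.
           norm (X \<tau>) \<le> C * (MAX j\<in>{0..CARD('m) - 1}. cmod \<tau> ^ j * Im \<tau> powr (-\<zeta>))) \<longrightarrow>
        (\<exists>n \<sigma>. irreducible_constituent (PSL2R\<lparr>carrier := G\<rparr>) \<rho> n \<sigma> \<and>
           (\<exists>C. \<forall>\<gamma>\<in>G. \<forall>A\<in>\<gamma>.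
              entries_norm n (\<sigma> \<gamma>) \<le>
                C * (MAX j\<in>{0..CARD('m) - 1}. norm A powr (real j + 2 * \<zeta> - of_int k)))))"
proof (intro conjI allI impI)
  note G = assms(1,5,6) and nz = assms(4)
  fix \<zeta> :: real
  let ?s = "2 * \<zeta> - of_int k"
  have add: "real j + 2 * \<zeta> - of_int k = real j + ?s" for j by simp
  {
    assume "\<exists>C. \<forall>\<tau>\<in>upper_half_plane. norm (X \<tau>) \<le> C * Im \<tau> powr (-\<zeta>)"
    then have growth: "polynomial_growth 0 \<zeta> X" using polynomial_growthI by blast
    show "\<exists>C. \<forall>\<gamma>\<in>G. \<forall>A\<in>\<gamma>. norm (\<rho> \<gamma>) \<le> C * norm A powr ?s"
      if "irreducible_representation (PSL2R\<lparr>carrier := G\<rparr>) \<rho>"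
      using irreducible_growth[OF G growth nz that] by blast
    show "\<exists>n \<sigma>. irreducible_constituent (PSL2R\<lparr>carrier := G\<rparr>) \<rho> n \<sigma> \<and>
        (\<exists>C. \<forall>\<gamma>\<in>G. \<forall>A\<in>\<gamma>. entries_norm n (\<sigma> \<gamma>) \<le> C * norm A powr ?s)"
      using constituent_growth[OF G growth nz] by blast
  next
    assume "\<exists>C. \<forall>\<tau>\<in>upper_half_plane. norm (X \<tau>) \<le>
      C * (MAX j\<in>{0..CARD('m) - 1}. cmod \<tau> ^ j * Im \<tau> powr (-\<zeta>))"
    then have growth: "polynomial_growth (CARD('m) - 1) \<zeta> X" using polynomial_growth_MaxI by blast
    show "\<exists>C. \<forall>\<gamma>\<in>G. \<forall>A\<in>\<gamma>. norm (\<rho> \<gamma>) \<le>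
        C * (MAX j\<in>{0..CARD('m) - 1}. norm A powr (real j + 2 * \<zeta> - of_int k))"
      if irr: "irreducible_representation (PSL2R\<lparr>carrier := G\<rparr>) \<rho>"
    proof -
      obtain C where C: "C \<ge> 0" "\<forall>\<gamma>\<in>G. \<forall>A\<in>\<gamma>. norm (\<rho> \<gamma>) \<le> C * norm A powr ?s"
        using irreducible_growth[OF G growth nz irr] by blast
      show ?thesis
        unfolding add using C(2) order_trans[OF _ powr_le_Max_powr[OF C(1)]] by blast
    qed
    show "\<exists>n \<sigma>. irreducible_constituent (PSL2R\<lparr>carrier := G\<rparr>) \<rho> n \<sigma> \<and>
        (\<exists>C. \<forall>\<gamma>\<in>G. \<forall>A\<in>\<gamma>. entries_norm n (\<sigma> \<gamma>) \<le>
          C * (MAX j\<in>{0..CARD('m) - 1}. norm A powr (real j + 2 * \<zeta> - of_int k)))"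
    proof -
      obtain n \<sigma> C where irr: "irreducible_constituent (PSL2R\<lparr>carrier := G\<rparr>) \<rho> n \<sigma>"
        and C: "C \<ge> 0" "\<forall>\<gamma>\<in>G. \<forall>A\<in>\<gamma>. entries_norm n (\<sigma> \<gamma>) \<le> C * norm A powr ?s"
        using constituent_growth[OF G growth nz] by blast
      show ?thesis
        unfolding add using irr C(2) order_trans[OF _ powr_le_Max_powr[OF C(1)]] by blast
    qed
  }
qed

end
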